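(* Let $s>0$, $m>0$, $n>0$ and consider the Lurye system $y_1=Gu_1$, $y_2=\phi u_2$, $u_1=r_1-y_2$, $u_2=y_1+r_2$, assumed well-posed, with $G:\mathcal{L}_{2e}\to\mathcal{L}_{2e}$ linear time-invariant, causal and stable, and $\phi:\mathcal{L}_{2e}\to\mathcal{L}_{2e}$ given by the asymmetric saturation $(\phi u)(t)=\mathrm{sat}_{s,-m,n}(u(t))$, where $$\mathrm{sat}_{s,-m,n}(x)=\begin{cases}-m & x<-m/s,\\ sx & -m/s\le x\le n/s,\\ n & x>n/s.\end{cases}$$ Let $k\ge s$ and let $$B_k=\frac{\max\{m,n\}}{\min\{m,n\}} .$$ Let $H_+$ and $H_-$ be (not necessarily causal) convolution operators whose impulse responses are respectively $h_+\in\mathbf{H_p}$ and $h_-\in\mathbf{H_p}$, satisfying $$\|h_+\|_H+B_k\|h_-\|_H<1 .$$ Let $M=1-H_++H_-$. Then for any $u\in\mathcal{L}_2$, $$\int_{-\infty}^{\infty}\big(M(u-\phi u/k)\big)(t)\,(\phi u)(t)\,dt\ge 0 ,$$ and the Lurye system is stable provided there exists $\varepsilon>0$ such that $\mathrm{Re}\left[M(j\omega)(1+kG(j\omega))\right]\ge\varepsilon$ for all $\omega\in\mathbb{R}$.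
   Context: Signals are real-valued measurable functions of $t\in\mathbb{R}$. $\mathcal{L}_2$ is the space of square-integrable signals; $\mathcal{L}_{2e}$ is the extended space of signals all of whose truncations $x_T$ ($x_T(t)=x(t)$ for $t\le T$, $x_T(t)=0$ for $t>T$) lie in $\mathcal{L}_2$. The Lurye system is well-posed if for all $r_1,r_2\in\mathcal{L}_{2e}$ there are unique $u_1,u_2,y_1,y_2\in\mathcal{L}_{2e}$ satisfying its equations. It is stable if $r_1,r_2\in\mathcal{L}_2$ implies $u_1,u_2,y_1,y_2\in\mathcal{L}_2$. Stability of $G$ means that it maps $\mathcal{L}_2$ boundedly into $\mathcal{L}_2$; $G(j\omega)$ and $M(j\omega)$ denote frequency responses. $\mathbf{H}$ is the set of generalized functions $h(t)=\sum_i h_i\delta(t-t_i)+h_a(t)$ with $t_i\neq0$, $h_a(0)=0$, $h_i\in\mathbb{R}$, $h_a(t)\in\mathbb{R}$, and $\|h\|_H=\sum_i|h_i|+\int_{-\infty}^{\infty}|h_a(t)|\,dt<\infty$. $\mathbf{H_p}\subset\mathbf{H}$ is the subset with $h_i\ge0$ for all $i$ and $h_a(t)\ge0$ for all $t$. $M=1-H_++H_-$ has impulse response $\delta(t)-h_+(t)+h_-(t)$. *)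

theory Defs
  imports "HOL-Analysis.Analysis"
begin

section \<open>Signals\<close>

text \<open>
  Signals are Borel functions standing for their classes modulo Lebesgue null sets, so equations
  between signals are read as almost-everywhere equalities.
\<close>

type_synonym signal = "real \<Rightarrow> real"

definition ae_eq :: "signal \<Rightarrow> signal \<Rightarrow> bool"  (infix "\<doteq>" 50) where
  "u \<doteq> v \<longleftrightarrow> (AE t in lborel. u t = v t)"

definition L2 :: "signal set" where
  "L2 = {u \<in> borel_measurable borel. integrable lborel (\<lambda>t. (u t)\<^sup>2)}"

definition L2_norm :: "signal \<Rightarrow> real" where
  "L2_norm u = sqrt (LBINT t. (u t)\<^sup>2)"

definition trunc :: "real \<Rightarrow> signal \<Rightarrow> signal" where
  "trunc T x = (\<lambda>t. if t \<le> T then x t else 0)"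

definition L2e :: "signal set" where
  "L2e = {x \<in> borel_measurable borel. \<forall>T. trunc T x \<in> L2}"

section \<open>Operators on the extended space\<close>

type_synonym sysop = "signal \<Rightarrow> signal"

definition L2e_operator :: "sysop \<Rightarrow> bool" where
  "L2e_operator G \<longleftrightarrow>
     (\<forall>u\<in>L2e. G u \<in> L2e) \<and> (\<forall>u\<in>L2e. \<forall>v\<in>L2e. u \<doteq> v \<longrightarrow> G u \<doteq> G v)"

definition linear_op :: "sysop \<Rightarrow> bool" where
  "linear_op G \<longleftrightarrow> (\<forall>u\<in>L2e. \<forall>v\<in>L2e. \<forall>a b.
     G (\<lambda>t. a * u t + b * v t) \<doteq> (\<lambda>t. a * G u t + b * G v t))"

definition time_invariant :: "sysop \<Rightarrow> bool" where
  "time_invariant G \<longleftrightarrow> (\<forall>u\<in>L2e. \<forall>\<tau>. G (\<lambda>t. u (t - \<tau>)) \<doteq> (\<lambda>t. G u (t - \<tau>)))"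

definition causal :: "sysop \<Rightarrow> bool" where
  "causal G \<longleftrightarrow> (\<forall>u\<in>L2e. \<forall>T. trunc T (G u) \<doteq> trunc T (G (trunc T u)))"

definition stable_op :: "sysop \<Rightarrow> bool" where
  "stable_op G \<longleftrightarrow> (\<exists>\<gamma>. \<forall>u\<in>L2. G u \<in> L2 \<and> L2_norm (G u) \<le> \<gamma> * L2_norm u)"

section \<open>Frequency responses\<close>

text \<open>
  \<open>U\<close> is the Fourier--Plancherel transform of \<open>u \<in> L2\<close>: the limit in mean square of the
  transforms of \<open>u\<close> restricted to \<open>[-R, R]\<close>.
\<close>

definition is_fourier :: "signal \<Rightarrow> (real \<Rightarrow> complex) \<Rightarrow> bool" where
  "is_fourier u U \<longleftrightarrow>
     U \<in> borel_measurable borel \<and>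
     ((\<lambda>R::real. \<integral>\<^sup>+\<omega>. ennreal ((cmod (U \<omega> -
          (CLBINT t:{-R..R}. complex_of_real (u t) * cis (- (\<omega> * t)))))\<^sup>2) \<partial>lborel)
        \<longlongrightarrow> 0) at_top"

text \<open>
  \<open>\<omega> \<mapsto> G(j\<omega>)\<close> is only determined up to null sets, whence a relation.
\<close>

definition frequency_response :: "sysop \<Rightarrow> (real \<Rightarrow> complex) \<Rightarrow> bool" where
  "frequency_response G Gj \<longleftrightarrow>
     Gj \<in> borel_measurable borel \<and>
     (\<forall>u\<in>L2. \<forall>U. is_fourier u U \<longrightarrow> is_fourier (G u) (\<lambda>\<omega>. Gj \<omega> * U \<omega>))"

section \<open>Impulse responses and multipliers\<close>

text \<open>
  The generalized function \<open>\<Sum>\<^sub>i h\<^sub>i \<delta>(t - t\<^sub>i) + h\<^sub>a(t)\<close> is stored as \<open>h\<^sub>a\<close> together with the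
  function mapping each \<open>t\<^sub>i\<close> to \<open>h\<^sub>i\<close> and every other point to \<open>0\<close>. Absolute summability forces
  the set of nonzero atoms to be countable.
\<close>

record gen_fun =
  atom :: "real \<Rightarrow> real"
  dens :: "real \<Rightarrow> real"

definition H_space :: "gen_fun set" where
  "H_space = {h. atom h 0 = 0 \<and> (\<lambda>\<tau>. \<bar>atom h \<tau>\<bar>) summable_on UNIV \<and>
                 dens h 0 = 0 \<and> integrable lborel (dens h)}"

definition H_norm :: "gen_fun \<Rightarrow> real" where
  "H_norm h = (\<Sum>\<^sub>\<infinity>\<tau>. \<bar>atom h \<tau>\<bar>) + (LBINT t. \<bar>dens h t\<bar>)"

definition Hp_space :: "gen_fun set" where
  "Hp_space = {h \<in> H_space. (\<forall>\<tau>. atom h \<tau> \<ge> 0) \<and> (\<forall>t. dens h t \<ge> 0)}"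

definition conv_op :: "gen_fun \<Rightarrow> sysop" where
  "conv_op h u = (\<lambda>t. (\<Sum>\<^sub>\<infinity>\<tau>. atom h \<tau> * u (t - \<tau>)) + (LBINT \<tau>. dens h \<tau> * u (t - \<tau>)))"

definition conv_freq :: "gen_fun \<Rightarrow> real \<Rightarrow> complex" where
  "conv_freq h \<omega> = (\<Sum>\<^sub>\<infinity>\<tau>. complex_of_real (atom h \<tau>) * cis (- (\<omega> * \<tau>))) +
                   (CLBINT t. complex_of_real (dens h t) * cis (- (\<omega> * t)))"

definition multiplier :: "gen_fun \<Rightarrow> gen_fun \<Rightarrow> sysop" where
  "multiplier hp hm u = (\<lambda>t. u t - conv_op hp u t + conv_op hm u t)"

definition multiplier_freq :: "gen_fun \<Rightarrow> gen_fun \<Rightarrow> real \<Rightarrow> complex" where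
  "multiplier_freq hp hm \<omega> = 1 - conv_freq hp \<omega> + conv_freq hm \<omega>"

section \<open>The Lurye system\<close>

definition sat :: "real \<Rightarrow> real \<Rightarrow> real \<Rightarrow> real \<Rightarrow> real" where
  "sat s a b x = (if x < a / s then a else if x \<le> b / s then s * x else b)"

definition sat_op :: "real \<Rightarrow> real \<Rightarrow> real \<Rightarrow> sysop" where
  "sat_op s a b u = (\<lambda>t. sat s a b (u t))"

definition lurye_solution ::
  "sysop \<Rightarrow> sysop \<Rightarrow> signal \<Rightarrow> signal \<Rightarrow> signal \<Rightarrow> signal \<Rightarrow> signal \<Rightarrow> signal \<Rightarrow> bool" where
  "lurye_solution G \<phi> r1 r2 u1 u2 y1 y2 \<longleftrightarrow>
     u1 \<in> L2e \<and> u2 \<in> L2e \<and> y1 \<in> L2e \<and> y2 \<in> L2e \<and>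
     y1 \<doteq> G u1 \<and> y2 \<doteq> \<phi> u2 \<and>
     u1 \<doteq> (\<lambda>t. r1 t - y2 t) \<and> u2 \<doteq> (\<lambda>t. y1 t + r2 t)"

definition lurye_well_posed :: "sysop \<Rightarrow> sysop \<Rightarrow> bool" where
  "lurye_well_posed G \<phi> \<longleftrightarrow> (\<forall>r1\<in>L2e. \<forall>r2\<in>L2e.
     (\<exists>u1 u2 y1 y2. lurye_solution G \<phi> r1 r2 u1 u2 y1 y2) \<and>
     (\<forall>u1 u2 y1 y2 u1' u2' y1' y2'.
        lurye_solution G \<phi> r1 r2 u1 u2 y1 y2 \<and> lurye_solution G \<phi> r1 r2 u1' u2' y1' y2' \<longrightarrow>
        u1 \<doteq> u1' \<and> u2 \<doteq> u2' \<and> y1 \<doteq> y1' \<and> y2 \<doteq> y2'))"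

definition lurye_stable :: "sysop \<Rightarrow> sysop \<Rightarrow> bool" where
  "lurye_stable G \<phi> \<longleftrightarrow> (\<forall>r1\<in>L2. \<forall>r2\<in>L2. \<forall>u1 u2 y1 y2.
     lurye_solution G \<phi> r1 r2 u1 u2 y1 y2 \<longrightarrow>
     u1 \<in> L2 \<and> u2 \<in> L2 \<and> y1 \<in> L2 \<and> y2 \<in> L2)"

end

theory Submission
  imports Defs "HOL-Probability.Characteristic_Functions"
begin

text \<open>
  Write \<open>w\<close> for the saturated signal and \<open>v = u - w / k\<close>. Pointwise, \<open>w\<close> is a subgradient at \<open>v\<close> of the
  convex function \<open>v w - c w\<^sup>2\<close> of \<open>v\<close>, where \<open>c = (1 / s - 1 / k) / 2\<close>, and this function grows
  at most \<open>B\<^sub>k\<close> times faster on one side of \<open>0\<close> than on the other. Integrating the subgradient and Fenchel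
  inequalities bounds the correlation of \<open>v\<close> and \<open>w\<close> at every lag between \<open>- B\<^sub>k\<langle>v, w\<rangle>\<close> and
  \<open>\<langle>v, w\<rangle>\<close>, which gives the positivity.

  Stability needs neither a factorization of the noncausal \<open>M\<close> nor a homotopy, because \<open>w\<close> is
  bounded. For the truncation \<open>w\<^sub>T\<close>, Parseval's identity gives
  \<open>\<epsilon> \<parallel>w\<^sub>T\<parallel>\<^sup>2 \<le> \<langle>M (1 + k G) w\<^sub>T, w\<^sub>T\<rangle>\<close>. Up to time \<open>T\<close> the loop equation and positivity
  control the right-hand side by \<open>O(\<parallel>w\<^sub>T\<parallel>)\<close>. What remains is the response \<open>q\<close> of \<open>G\<close> to \<open>w\<^sub>T\<close> after time
  \<open>T\<close>, and its correlation with \<open>w\<^sub>T\<close> at lag \<open>\<tau>\<close> only sees \<open>w\<close> on an interval of length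
  \<open>\<bar>\<tau>\<bar>\<close>, hence is \<open>O(\<parallel>q\<parallel> \<surd>\<bar>\<tau>\<bar>)\<close>. Large lags carry little mass of the impulse response, so
  \<open>\<parallel>w\<^sub>T\<parallel>\<close> is bounded independently of \<open>T\<close>.

  Parseval's identity is needed only against bounded signals of bounded support. It is Fourier inversion,
  by Gaussian regularization, for their correlations, which are continuous because translation is
  continuous in mean square; the frequency inequality then extends by density.
\<close>

section \<open>Square-integrable signals and convolution forms\<close>

definition ip :: "signal \<Rightarrow> signal \<Rightarrow> real" where
  "ip x y = (LBINT t. x t * y t)"

lemma L2_measurable: "x \<in> L2 \<Longrightarrow> x \<in> borel_measurable borel"
  by (simp add: L2_def)

lemma L2_square_integrable: "x \<in> L2 \<Longrightarrow> integrable lborel (\<lambda>t. (x t)\<^sup>2)"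
  by (simp add: L2_def)

lemma L2_I: "x \<in> borel_measurable borel \<Longrightarrow> integrable lborel (\<lambda>t. (x t)\<^sup>2) \<Longrightarrow> x \<in> L2"
  by (simp add: L2_def)

lemma L2_mult_integrable:
  assumes "x \<in> L2" "y \<in> L2"
  shows "integrable lborel (\<lambda>t. x t * y t)"
proof (rule Bochner_Integration.integrable_bound)
  show "integrable lborel (\<lambda>t. (x t)\<^sup>2 + (y t)\<^sup>2)"
    using assms by (simp add: L2_def)
  show "(\<lambda>t. x t * y t) \<in> borel_measurable lborel"
    using assms by (auto simp: L2_def)
  show "AE t in lborel. norm (x t * y t) \<le> norm ((x t)\<^sup>2 + (y t)\<^sup>2)"
  proof (rule AE_I2)
    fix t
    have "0 \<le> (\<bar>x t\<bar> - \<bar>y t\<bar>)\<^sup>2" by simp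
    also have "\<dots> = (x t)\<^sup>2 + (y t)\<^sup>2 - 2 * \<bar>x t * y t\<bar>"
      by (simp add: power2_diff abs_mult)
    finally have "\<bar>x t * y t\<bar> \<le> (x t)\<^sup>2 + (y t)\<^sup>2" by linarith
    then show "norm (x t * y t) \<le> norm ((x t)\<^sup>2 + (y t)\<^sup>2)" by simp
  qed
qed

lemma L2_add: 
  assumes "x \<in> L2" "y \<in> L2"
  shows "(\<lambda>t. x t + y t) \<in> L2"
proof (rule L2_I)
  show "(\<lambda>t. x t + y t) \<in> borel_measurable borel"
    using assms by (auto simp: L2_def)
  have "integrable lborel (\<lambda>t. (x t)\<^sup>2 + (y t)\<^sup>2 + 2 * (x t * y t))"
    using assms L2_mult_integrable[OF assms] by (intro Bochner_Integration.integrable_add) (auto simp: L2_def)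
  then show "integrable lborel (\<lambda>t. (x t + y t)\<^sup>2)"
    by (simp add: power2_sum mult.assoc)
qed

lemma L2_scale: "x \<in> L2 \<Longrightarrow> (\<lambda>t. c * x t) \<in> L2"
  by (auto simp: L2_def power_mult_distrib)

lemma L2_diff: "x \<in> L2 \<Longrightarrow> y \<in> L2 \<Longrightarrow> (\<lambda>t. x t - y t) \<in> L2"
  using L2_add[of x "\<lambda>t. (-1) * y t"] L2_scale[of y "-1"] by simp

lemma L2_divide: "x \<in> L2 \<Longrightarrow> (\<lambda>t. x t / c) \<in> L2"
  using L2_scale[of x "1/c"] by simp

lemma L2_bound:
  assumes "y \<in> borel_measurable borel" "x \<in> L2" "\<And>t. \<bar>y t\<bar> \<le> \<bar>x t\<bar>"
  shows "y \<in> L2"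
proof (rule L2_I[OF assms(1)])
  have "(y t)\<^sup>2 \<le> (x t)\<^sup>2" for t
    using assms(3) by (metis abs_le_square_iff)
  then show "integrable lborel (\<lambda>t. (y t)\<^sup>2)"
    using assms(1,2)
    by (intro Bochner_Integration.integrable_bound[OF L2_square_integrable[OF assms(2)]]) auto
qed

lemma L2_ae_eq:
  assumes "x \<in> L2" "y \<in> borel_measurable borel" "x \<doteq> y"
  shows "y \<in> L2"
proof (rule L2_I[OF assms(2)])
  have "AE t in lborel. (x t)\<^sup>2 = (y t)\<^sup>2"
    using assms(3) unfolding ae_eq_def by eventually_elim simp
  moreover have "(\<lambda>t. (y t)\<^sup>2) \<in> borel_measurable lborel"
    using assms(2) by measurable
  ultimately show "integrable lborel (\<lambda>t. (y t)\<^sup>2)"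
    using L2_square_integrable[OF assms(1)] assms(1)
    by (subst integrable_cong_AE[symmetric]) (auto simp: L2_def)
qed

lemma L2_norm_nonneg: "0 \<le> L2_norm x"
  by (simp add: L2_norm_def)

lemma L2_norm_power2: "(L2_norm x)\<^sup>2 = ip x x"
  by (simp add: L2_norm_def ip_def power2_eq_square)

lemma L2_norm_mono:
  assumes "y \<in> borel_measurable borel" "x \<in> L2" "\<And>t. \<bar>y t\<bar> \<le> \<bar>x t\<bar>"
  shows "L2_norm y \<le> L2_norm x"
  unfolding L2_norm_def
  using assms L2_bound[OF assms]
  by (intro real_sqrt_le_mono integral_mono) (auto simp: L2_def simp flip: abs_le_square_iff)

lemma L2_norm_ae_eq:
  assumes "x \<doteq> y" "x \<in> borel_measurable borel" "y \<in> borel_measurable borel"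
  shows "L2_norm x = L2_norm y"
proof -
  have "AE t in lborel. (x t)\<^sup>2 = (y t)\<^sup>2"
    using assms(1) unfolding ae_eq_def by eventually_elim simp
  then show ?thesis
    unfolding L2_norm_def using assms(2,3)
    by (intro arg_cong[where f=sqrt] integral_cong_AE) auto
qed

lemma ip_add_left: "x \<in> L2 \<Longrightarrow> y \<in> L2 \<Longrightarrow> z \<in> L2 \<Longrightarrow> ip (\<lambda>t. x t + y t) z = ip x z + ip y z"
  unfolding ip_def by (simp add: distrib_right L2_mult_integrable)

lemma ip_diff_left: "x \<in> L2 \<Longrightarrow> y \<in> L2 \<Longrightarrow> z \<in> L2 \<Longrightarrow> ip (\<lambda>t. x t - y t) z = ip x z - ip y z"
  unfolding ip_def by (simp add: left_diff_distrib L2_mult_integrable)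

lemma ip_scale_left: "ip (\<lambda>t. c * x t) z = c * ip x z"
  unfolding ip_def by (simp add: mult.assoc)

lemma ip_commute: "ip x y = ip y x"
  unfolding ip_def by (simp add: mult.commute)

lemma ip_lincomb:
  assumes "x \<in> L2" "y \<in> L2"
  shows "ip (\<lambda>t. a * x t + b * y t) (\<lambda>t. a * x t + b * y t)
    = a\<^sup>2 * ip x x + 2 * a * b * ip x y + b\<^sup>2 * ip y y"
proof -
  have "(a * x t + b * y t) * (a * x t + b * y t)
      = a\<^sup>2 * (x t * x t) + (2 * a * b) * (x t * y t) + b\<^sup>2 * (y t * y t)" for t
    by (simp add: power2_eq_square algebra_simps)
  then show ?thesis
    unfolding ip_def using assms by (simp add: L2_mult_integrable)
qed

text \<open>Discriminant argument for the nonnegative quadratic form \<open>quad\<close>. When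
  \<open>ip y y = 0\<close> the form is affine in \<open>b\<close> for fixed \<open>a\<close>, so a
  nonzero cross term would make it negative somewhere; no null-set reasoning about \<open>y\<close>
  enters.\<close>

lemma Cauchy_Schwarz_L2:
  assumes "x \<in> L2" "y \<in> L2"
  shows "\<bar>ip x y\<bar> \<le> L2_norm x * L2_norm y"
proof -
  have quad: "0 \<le> a\<^sup>2 * ip x x + 2 * a * b * ip x y + b\<^sup>2 * ip y y" for a b
  proof -
    have "0 \<le> ip (\<lambda>t. a * x t + b * y t) (\<lambda>t. a * x t + b * y t)"
      unfolding ip_def by (intro Bochner_Integration.integral_nonneg) simp
    also have "\<dots> = a\<^sup>2 * ip x x + 2 * a * b * ip x y + b\<^sup>2 * ip y y"
      using ip_lincomb[OF assms] .
    finally show ?thesis .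
  qed
  have "(ip x y)\<^sup>2 \<le> ip x x * ip y y"
  proof (cases "ip y y = 0")
    case True
    have "ip x y = 0"
    proof (rule ccontr)
      assume "ip x y \<noteq> 0"
      \<comment> \<open>The second coefficient is chosen so that the form takes the value
        -1.\<close>
      then show False
        using quad[of 1 "- (ip x x + 1) / (2 * ip x y)"] True by (simp add: field_simps)
    qed
    then show ?thesis using True by simp
  next
    case False
    moreover have "0 \<le> ip y y" using L2_norm_power2[of y] by (metis zero_le_power2)
    ultimately have pos: "0 < ip y y" by simp
    \<comment> \<open>The minimizing pair of coefficients, scaled by \<open>ip y y\<close> to avoid
      a division.\<close>
    have "0 \<le> ip y y * (ip x x * ip y y - (ip x y)\<^sup>2)"
      using quad[of "ip y y" "- ip x y"] by (simp add: power2_eq_square algebra_simps)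
    then show ?thesis using pos by (simp add: zero_le_mult_iff)
  qed
  then have "(ip x y)\<^sup>2 \<le> (L2_norm x * L2_norm y)\<^sup>2"
    by (simp add: power_mult_distrib L2_norm_power2)
  then show ?thesis
    using L2_norm_nonneg[of x] L2_norm_nonneg[of y] by (simp add: abs_le_square_iff[symmetric] abs_mult)
qed

lemma L2_norm_add_le:
  assumes "x \<in> L2" "y \<in> L2"
  shows "L2_norm (\<lambda>t. x t + y t) \<le> L2_norm x + L2_norm y"
proof -
  have "(L2_norm (\<lambda>t. x t + y t))\<^sup>2 = ip x x + 2 * ip x y + ip y y"
    unfolding L2_norm_power2 using ip_lincomb[OF assms, of 1 1] by simp
  also have "\<dots> \<le> (L2_norm x + L2_norm y)\<^sup>2"
    using Cauchy_Schwarz_L2[OF assms] by (simp add: power2_sum L2_norm_power2)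
  finally show ?thesis
    using L2_norm_nonneg[of x] L2_norm_nonneg[of y] by (simp add: abs_le_square_iff[symmetric])
qed

section \<open>Translations and correlations\<close>

lemma integral_translate:
  fixes f :: "real \<Rightarrow> 'a::{banach, second_countable_topology}"
  shows "(LBINT t. f (t - a)) = (LBINT t. f t)"
  using lborel_integral_real_affine[of 1 f "-a"] by simp

lemma integrable_translate:
  fixes f :: "real \<Rightarrow> 'a::{banach, second_countable_topology}"
  shows "integrable lborel f \<Longrightarrow> integrable lborel (\<lambda>t. f (t - a))"
  using lborel_integrable_real_affine[of f 1 "-a"] by simp

lemma L2_translate: "x \<in> L2 \<Longrightarrow> (\<lambda>t. x (t - a)) \<in> L2"
  using integrable_translate[of "\<lambda>t. (x t)\<^sup>2" a] by (auto simp: L2_def)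

lemma L2_norm_translate: "L2_norm (\<lambda>t. x (t - a)) = L2_norm x"
  unfolding L2_norm_def using integral_translate[of "\<lambda>t. (x t)\<^sup>2" a] by simp

text \<open>Pairing a convolution with \<open>y\<close> integrates this function of the lag against
  the impulse response, so every estimate on a multiplier becomes an estimate on correlations that
  is uniform in the lag.\<close>

definition corr :: "signal \<Rightarrow> signal \<Rightarrow> real \<Rightarrow> real" where
  "corr x y \<tau> = ip (\<lambda>t. x (t - \<tau>)) y"

lemma corr_le: "x \<in> L2 \<Longrightarrow> y \<in> L2 \<Longrightarrow> \<bar>corr x y \<tau>\<bar> \<le> L2_norm x * L2_norm y"
  unfolding corr_def using Cauchy_Schwarz_L2[OF L2_translate] L2_norm_translate by metis

lemma corr_0: "corr x y 0 = ip x y"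
  by (simp add: corr_def)

lemma corr_measurable:
  assumes "x \<in> borel_measurable borel" "y \<in> borel_measurable borel"
  shows "corr x y \<in> borel_measurable borel"
proof -
  note assms[measurable]
  have "(\<lambda>\<tau>. LBINT t. x (t - \<tau>) * y t) \<in> borel_measurable borel"
    by measurable
  then show ?thesis unfolding corr_def ip_def .
qed

section \<open>Integration against an impulse response\<close>

text \<open>
  The integral of \<open>g\<close> against the measure \<open>h\<close>, so that \<open>conv_op h u t\<close> is \<open>hint h (\<lambda>\<tau>. u (t - \<tau>))\<close>.
\<close>

definition hint :: "gen_fun \<Rightarrow> (real \<Rightarrow> 'a) \<Rightarrow> 'a::euclidean_space" where
  "hint h g = (\<Sum>\<^sub>\<infinity>\<tau>. atom h \<tau> *\<^sub>R g \<tau>) + (LBINT \<tau>. dens h \<tau> *\<^sub>R g \<tau>)"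

abbreviation atoms :: "gen_fun \<Rightarrow> real set" where
  "atoms h \<equiv> {\<tau>. atom h \<tau> \<noteq> 0}"

text \<open>In finite dimension summability is absolute, as seen coordinate by coordinate. Sums over
  atoms thereby become Lebesgue integrals, and atoms and density are handled by the same
  measure-theoretic arguments.\<close>

lemma summable_on_iff_integrable_count_space:
  fixes f :: "'a \<Rightarrow> 'b::euclidean_space"
  shows "f summable_on A \<longleftrightarrow> integrable (count_space A) f"
proof
  assume f: "f summable_on A"
  have "integrable (count_space A) (\<lambda>x. f x \<bullet> b)" for b
  proof -
    have "(\<lambda>x. f x \<bullet> b) summable_on A"
      using summable_on_bounded_linear[OF bounded_linear_inner_left f] by (simp add: o_def)
    then have "(\<lambda>x. norm (f x \<bullet> b)) summable_on A"
      by (rule summable_on_iff_abs_summable_on_real[THEN iffD1])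
    then have "Infinite_Set_Sum.abs_summable_on (\<lambda>x. f x \<bullet> b) A"
      by (rule abs_summable_equivalent[THEN iffD1])
    then show ?thesis unfolding abs_summable_on_def .
  qed
  then have "integrable (count_space A) (\<lambda>x. \<Sum>b\<in>Basis. (f x \<bullet> b) *\<^sub>R b)"
    by (intro Bochner_Integration.integrable_sum integrable_scaleR_left) auto
  then show "integrable (count_space A) f" by (simp add: euclidean_representation)
next
  assume "integrable (count_space A) f"
  then have "Infinite_Set_Sum.abs_summable_on f A" unfolding abs_summable_on_def .
  then show "f summable_on A"
    by (rule abs_summable_equivalent[THEN iffD2, THEN abs_summable_summable])
qed

lemma infsum_eq_integral_count_space:
  fixes f :: "'a \<Rightarrow> 'b::euclidean_space"
  shows "infsum f A = integral\<^sup>L (count_space A) f"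
proof (cases "f summable_on A")
  case True
  then have "Infinite_Set_Sum.abs_summable_on f A"
    by (simp add: summable_on_iff_integrable_count_space abs_summable_on_def)
  then show ?thesis
    using infsetsum_infsum[of f A] by (simp add: infsetsum_def)
next
  \<comment> \<open>Without summability both sides take the default value 0.\<close>
  case False
  then show ?thesis
    by (simp add: infsum_not_exists summable_on_iff_integrable_count_space not_integrable_integral_eq)
qed

text \<open>The counting measure is restricted to the support of the atoms because it is
  sigma-finite there once the support is countable, as Fubini requires.\<close>

lemma hint_eq_integrals:
  "hint h g = (LINT \<tau>|count_space (atoms h). atom h \<tau> *\<^sub>R g \<tau>) + (LBINT \<tau>. dens h \<tau> *\<^sub>R g \<tau>)"
proof -
  have "(\<Sum>\<^sub>\<infinity>\<tau>. atom h \<tau> *\<^sub>R g \<tau>) = (\<Sum>\<^sub>\<infinity>\<tau>\<in>atoms h. atom h \<tau> *\<^sub>R g \<tau>)"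
    by (rule infsum_cong_neutral) auto
  then show ?thesis
    by (simp add: hint_def infsum_eq_integral_count_space)
qed

lemma H_norm_eq: "H_norm h = (LINT \<tau>|count_space (atoms h). \<bar>atom h \<tau>\<bar>) + (LBINT \<tau>. \<bar>dens h \<tau>\<bar>)"
proof -
  have "(\<Sum>\<^sub>\<infinity>\<tau>. \<bar>atom h \<tau>\<bar>) = (\<Sum>\<^sub>\<infinity>\<tau>\<in>atoms h. \<bar>atom h \<tau>\<bar>)"
    by (rule infsum_cong_neutral) auto
  then show ?thesis
    by (simp add: H_norm_def infsum_eq_integral_count_space)
qed

lemma H_space_atoms:
  assumes "h \<in> H_space"
  shows "integrable (count_space (atoms h)) (atom h)" and "countable (atoms h)"
proof -
  have s: "(\<lambda>\<tau>. \<bar>atom h \<tau>\<bar>) summable_on UNIV" using assms by (simp add: H_space_def)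
  then have "(\<lambda>\<tau>. \<bar>atom h \<tau>\<bar>) summable_on atoms h"
    by (rule summable_on_subset_banach) simp
  then show "integrable (count_space (atoms h)) (atom h)"
    by (simp only: summable_on_iff_integrable_count_space[symmetric]
      summable_on_iff_abs_summable_on_real[of "atom h"] real_norm_def)
  have "countable {\<tau> \<in> UNIV. norm (atom h \<tau>) \<noteq> 0}"
    using abs_summable_countable[of "atom h" UNIV] s by simp
  then show "countable (atoms h)" by simp
qed

lemma H_space_dens: "h \<in> H_space \<Longrightarrow> integrable lborel (dens h)"
  by (simp add: H_space_def)

lemma H_norm_nonneg: "0 \<le> H_norm h"
  unfolding H_norm_def by (intro add_nonneg_nonneg infsum_nonneg Bochner_Integration.integral_nonneg) auto

lemma integrable_scaleR_bounded:
  fixes c :: "'b \<Rightarrow> real" and g :: "'b \<Rightarrow> 'a::{banach, second_countable_topology}"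
  assumes "integrable N c" "g \<in> borel_measurable N" "\<And>\<tau>. norm (g \<tau>) \<le> K"
  shows "integrable N (\<lambda>\<tau>. c \<tau> *\<^sub>R g \<tau>)"
proof (rule Bochner_Integration.integrable_bound)
  show "integrable N (\<lambda>\<tau>. K * c \<tau>)" using assms(1) by simp
  show "(\<lambda>\<tau>. c \<tau> *\<^sub>R g \<tau>) \<in> borel_measurable N"
    using assms(1,2) by measurable
  have "\<bar>c \<tau>\<bar> * norm (g \<tau>) \<le> \<bar>K\<bar> * \<bar>c \<tau>\<bar>" for \<tau>
    using assms(3)[of \<tau>] by (metis abs_ge_self abs_ge_zero mult.commute mult_right_mono order_trans)
  then show "AE \<tau> in N. norm (c \<tau> *\<^sub>R g \<tau>) \<le> norm (K * c \<tau>)"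
    by (simp add: abs_mult)
qed

lemma hint_integrable:
  fixes g :: "real \<Rightarrow> 'a::euclidean_space"
  assumes "h \<in> H_space" "g \<in> borel_measurable borel" "\<And>\<tau>. norm (g \<tau>) \<le> K"
  shows "integrable (count_space (atoms h)) (\<lambda>\<tau>. atom h \<tau> *\<^sub>R g \<tau>)"
    and "integrable lborel (\<lambda>\<tau>. dens h \<tau> *\<^sub>R g \<tau>)"
proof -
  show "integrable (count_space (atoms h)) (\<lambda>\<tau>. atom h \<tau> *\<^sub>R g \<tau>)"
    by (rule integrable_scaleR_bounded[where K = K]) (use H_space_atoms[OF assms(1)] assms(3) in auto)
  show "integrable lborel (\<lambda>\<tau>. dens h \<tau> *\<^sub>R g \<tau>)"
    by (rule integrable_scaleR_bounded[where K = K]) (use H_space_dens[OF assms(1)] assms(2,3) in auto)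
qed

lemma hint_add:
  assumes "h \<in> H_space" "f \<in> borel_measurable borel" "\<And>\<tau>. norm (f \<tau>) \<le> K"
    "g \<in> borel_measurable borel" "\<And>\<tau>. norm (g \<tau>) \<le> K'"
  shows "hint h (\<lambda>\<tau>. f \<tau> + g \<tau>) = hint h f + hint h g"
  unfolding hint_eq_integrals
  using hint_integrable[OF assms(1-3)] hint_integrable[OF assms(1,4,5)]
  by (simp add: scaleR_add_right)

lemma hint_scale:
  fixes g :: "real \<Rightarrow> real"
  shows "hint h (\<lambda>\<tau>. c * g \<tau>) = c * hint h g"
proof -
  have *: "x * (c * y) = c * (x * y)" for x y :: real by simp
  show ?thesis
    unfolding hint_eq_integrals by (simp add: distrib_left *)
qed

lemma norm_hint_le:
  assumes "h \<in> H_space" "g \<in> borel_measurable borel" "\<And>\<tau>. norm (g \<tau>) \<le> K"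
  shows "norm (hint h g) \<le> K * H_norm h"
proof -
  have 0: "K \<ge> 0" using assms(3) norm_ge_zero order_trans by blast
  have *: "norm (integral\<^sup>L N (\<lambda>\<tau>. c \<tau> *\<^sub>R g \<tau>)) \<le> K * (LINT \<tau>|N. \<bar>c \<tau>\<bar>)"
    if "integrable N c" "integrable N (\<lambda>\<tau>. c \<tau> *\<^sub>R g \<tau>)" for N :: "real measure" and c
  proof -
    have "norm (integral\<^sup>L N (\<lambda>\<tau>. c \<tau> *\<^sub>R g \<tau>)) \<le> (LINT \<tau>|N. \<bar>c \<tau>\<bar> * K)"
    proof (rule Bochner_Integration.integral_norm_bound_integral[OF that(2)])
      show "integrable N (\<lambda>\<tau>. \<bar>c \<tau>\<bar> * K)" using that(1) by simp
      show "norm (c \<tau> *\<^sub>R g \<tau>) \<le> \<bar>c \<tau>\<bar> * K" for \<tau>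
        using assms(3)[of \<tau>] by (simp add: mult_left_mono)
    qed
    then show ?thesis by (simp add: mult.commute)
  qed
  have "norm (hint h g) \<le> K * (LINT \<tau>|count_space (atoms h). \<bar>atom h \<tau>\<bar>) + K * (LBINT \<tau>. \<bar>dens h \<tau>\<bar>)"
    unfolding hint_eq_integrals
    using *[OF H_space_atoms(1)[OF assms(1)] hint_integrable(1)[OF assms]]
      *[OF H_space_dens[OF assms(1)] hint_integrable(2)[OF assms]] norm_triangle_mono by blast
  then show ?thesis by (simp add: H_norm_eq distrib_left)
qed

lemma hint_mono:
  fixes f g :: "real \<Rightarrow> real"
  assumes "h \<in> Hp_space" "f \<in> borel_measurable borel" "\<And>\<tau>. norm (f \<tau>) \<le> K"
    "g \<in> borel_measurable borel" "\<And>\<tau>. norm (g \<tau>) \<le> K'" "\<And>\<tau>. f \<tau> \<le> g \<tau>"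
  shows "hint h f \<le> hint h g"
proof -
  have h: "h \<in> H_space" and "\<And>\<tau>. 0 \<le> atom h \<tau>" "\<And>\<tau>. 0 \<le> dens h \<tau>"
    using assms(1) by (auto simp: Hp_space_def)
  then show ?thesis
    unfolding hint_eq_integrals
    using hint_integrable[OF h assms(2,3)] hint_integrable[OF h assms(4,5)] assms(6)
    by (intro add_mono integral_mono) (auto intro: mult_left_mono)
qed

lemma hint_const:
  fixes c :: real
  assumes "h \<in> Hp_space"
  shows "hint h (\<lambda>_. c) = c * H_norm h"
proof -
  have "\<And>\<tau>. \<bar>atom h \<tau>\<bar> = atom h \<tau>" "\<And>\<tau>. \<bar>dens h \<tau>\<bar> = dens h \<tau>"
    using assms by (auto simp: Hp_space_def)
  then show ?thesis
    by (simp add: hint_eq_integrals H_norm_eq distrib_left mult.commute)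
qed

section \<open>Fubini for impulse responses\<close>

text \<open>One statement serves both components of an impulse response: \<open>N\<close> is either
  the counting measure on the atoms or Lebesgue measure, whence the measurability condition on the
  identity. Product integrability follows from the uniform bound \<open>K\<close> on the slices and
  integrability of \<open>c\<close>.\<close>

lemma kernel_Fubini:
  fixes F :: "real \<Rightarrow> real \<Rightarrow> 'a::{banach, second_countable_topology}" and c :: "real \<Rightarrow> real"
  assumes "sigma_finite_measure N" and id: "(\<lambda>\<tau>. \<tau>) \<in> N \<rightarrow>\<^sub>M borel" and c: "integrable N c"
    and F: "(\<lambda>(\<tau>, t). F \<tau> t) \<in> borel_measurable (borel \<Otimes>\<^sub>M borel)"
    and int: "\<And>\<tau>. integrable lborel (F \<tau>)" and K: "\<And>\<tau>. (LBINT t. norm (F \<tau> t)) \<le> K"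
  shows "integrable lborel (\<lambda>t. LINT \<tau>|N. c \<tau> *\<^sub>R F \<tau> t)"
    and "(LBINT t. LINT \<tau>|N. c \<tau> *\<^sub>R F \<tau> t) = (LINT \<tau>|N. c \<tau> *\<^sub>R (LBINT t. F \<tau> t))"
proof -
  interpret N: sigma_finite_measure N by fact
  interpret pair_sigma_finite N lborel ..
  note F[measurable] id[measurable] borel_measurable_integrable[OF c, measurable]
  have id2 [measurable]: "(\<lambda>p. fst p) \<in> N \<Otimes>\<^sub>M lborel \<rightarrow>\<^sub>M borel"
    using measurable_compose[OF measurable_fst id] by simp
  have "(\<lambda>p. (\<lambda>(\<tau>, t). F \<tau> t) (fst p, snd p)) \<in> borel_measurable (N \<Otimes>\<^sub>M lborel)"
    by measurable
  then have F' [measurable]: "(\<lambda>p. F (fst p) (snd p)) \<in> borel_measurable (N \<Otimes>\<^sub>M lborel)" by simp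
  have F'' [measurable]: "(\<lambda>(\<tau>, t). F \<tau> t) \<in> borel_measurable (N \<Otimes>\<^sub>M lborel)"
    using F' by (simp add: case_prod_beta')
  have I: "integrable (N \<Otimes>\<^sub>M lborel) (\<lambda>(\<tau>, t). c \<tau> *\<^sub>R F \<tau> t)"
  proof (rule Fubini_integrable)
    show "(\<lambda>(\<tau>, t). c \<tau> *\<^sub>R F \<tau> t) \<in> borel_measurable (N \<Otimes>\<^sub>M lborel)"
      by measurable
    have "integrable N (\<lambda>\<tau>. c \<tau> *\<^sub>R \<bar>LBINT t. norm (F \<tau> t)\<bar>)"
    proof (rule integrable_scaleR_bounded[OF c])
      show "(\<lambda>\<tau>. \<bar>LBINT t. norm (F \<tau> t)\<bar>) \<in> borel_measurable N" by measurable
      show "norm \<bar>LBINT t. norm (F \<tau> t)\<bar> \<le> K" for \<tau>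
        using K[of \<tau>] by (simp add: Bochner_Integration.integral_nonneg)
    qed
    then have "integrable N (\<lambda>\<tau>. \<bar>c \<tau> *\<^sub>R \<bar>LBINT t. norm (F \<tau> t)\<bar>\<bar>)"
      by (rule integrable_abs)
    then show "integrable N (\<lambda>x. LBINT y. norm (case (x, y) of (\<tau>, t) \<Rightarrow> c \<tau> *\<^sub>R F \<tau> t))"
      by (simp add: abs_mult Bochner_Integration.integral_nonneg)
    show "AE x in N. integrable lborel (\<lambda>y. case (x, y) of (\<tau>, t) \<Rightarrow> c \<tau> *\<^sub>R F \<tau> t)"
      using int by simp
  qed
  show "integrable lborel (\<lambda>t. LINT \<tau>|N. c \<tau> *\<^sub>R F \<tau> t)"
    using integrable_snd[OF I] by simp
  show "(LBINT t. LINT \<tau>|N. c \<tau> *\<^sub>R F \<tau> t) = (LINT \<tau>|N. c \<tau> *\<^sub>R (LBINT t. F \<tau> t))"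
    using Fubini_integral[OF I] by simp
qed

lemma hint_Fubini:
  fixes F :: "real \<Rightarrow> real \<Rightarrow> 'a::euclidean_space"
  assumes h: "h \<in> H_space" and F: "(\<lambda>(\<tau>, t). F \<tau> t) \<in> borel_measurable (borel \<Otimes>\<^sub>M borel)"
    and int: "\<And>\<tau>. integrable lborel (F \<tau>)" and K: "\<And>\<tau>. (LBINT t. norm (F \<tau> t)) \<le> K"
  shows "integrable lborel (\<lambda>t. hint h (\<lambda>\<tau>. F \<tau> t))"
    and "(LBINT t. hint h (\<lambda>\<tau>. F \<tau> t)) = hint h (\<lambda>\<tau>. LBINT t. F \<tau> t)"
proof -
  note A = kernel_Fubini[OF sigma_finite_measure_count_space_countable[OF H_space_atoms(2)[OF h]] _
      H_space_atoms(1)[OF h] F int K]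
  note D = kernel_Fubini[OF sigma_finite_lborel _ H_space_dens[OF h] F int K]
  show "integrable lborel (\<lambda>t. hint h (\<lambda>\<tau>. F \<tau> t))"
    unfolding hint_eq_integrals using A(1) D(1) by simp
  show "(LBINT t. hint h (\<lambda>\<tau>. F \<tau> t)) = hint h (\<lambda>\<tau>. LBINT t. F \<tau> t)"
    unfolding hint_eq_integrals using A D by simp
qed

text \<open>Fubini in the lag. Cauchy-Schwarz for the absolute values of \<open>x\<close> and
  \<open>y\<close> bounds the slices uniformly, since translation preserves the norm.\<close>

lemma conv_op_ip:
  assumes h: "h \<in> H_space" and x: "x \<in> L2" and y: "y \<in> L2"
  shows "integrable lborel (\<lambda>t. conv_op h x t * y t)" and "ip (conv_op h x) y = hint h (corr x y)"
proof -
  note [measurable] = L2_measurable[OF x] L2_measurable[OF y]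
  have eq: "conv_op h x t * y t = hint h (\<lambda>\<tau>. x (t - \<tau>) * y t)" for t
  proof -
    have "hint h (\<lambda>\<tau>. x (t - \<tau>) * y t) = hint h (\<lambda>\<tau>. y t * x (t - \<tau>))"
      by (simp add: mult.commute)
    also have "\<dots> = y t * hint h (\<lambda>\<tau>. x (t - \<tau>))"
      by (rule hint_scale)
    finally show ?thesis by (simp add: hint_def conv_op_def)
  qed
  have abs: "(\<lambda>t. \<bar>x t\<bar>) \<in> L2" "(\<lambda>t. \<bar>y t\<bar>) \<in> L2" "L2_norm (\<lambda>t. \<bar>x t\<bar>) = L2_norm x"
     "L2_norm (\<lambda>t. \<bar>y t\<bar>) = L2_norm y"
    using x y by (auto simp: L2_def L2_norm_def)
  have m: "(\<lambda>(\<tau>, t). x (t - \<tau>) * y t) \<in> borel_measurable (borel \<Otimes>\<^sub>M borel)" by measurable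
  have i: "integrable lborel (\<lambda>t. x (t - \<tau>) * y t)" for \<tau>
    using L2_mult_integrable[OF L2_translate[OF x] y] .
  have n: "(LBINT t. norm (x (t - \<tau>) * y t)) \<le> L2_norm x * L2_norm y" for \<tau>
    using corr_le[OF abs(1,2), of \<tau>] abs(3,4) by (simp add: corr_def ip_def abs_mult)
  show "integrable lborel (\<lambda>t. conv_op h x t * y t)"
    unfolding eq using hint_Fubini(1)[OF h m i n] .
  show "ip (conv_op h x) y = hint h (corr x y)"
    unfolding ip_def eq corr_def using hint_Fubini(2)[OF h m i n] .
qed

section \<open>Fourier transforms and Parseval's identity\<close>

text \<open>The absolutely convergent transform without normalizing factor, which is why
  \<open>2 * pi\<close> appears in inversion and in Parseval's identity.\<close>

definition ft :: "signal \<Rightarrow> real \<Rightarrow> complex" where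
  "ft f \<omega> = (CLBINT t. complex_of_real (f t) * cis (- (\<omega> * t)))"

lemma cis_measurable [measurable]: "cis \<in> borel_measurable borel"
  unfolding cis_conv_exp by (intro borel_measurable_continuous_onI continuous_intros)

lemma cnj_measurable [measurable]: "cnj \<in> borel_measurable borel"
  by (intro borel_measurable_continuous_onI continuous_intros)

lemma integrable_mult_bounded:
  fixes f g :: "'b \<Rightarrow> 'a::{banach, second_countable_topology, real_normed_algebra}"
  assumes "integrable N f" "g \<in> borel_measurable N" "\<And>\<tau>. norm (g \<tau>) \<le> K"
  shows "integrable N (\<lambda>\<tau>. f \<tau> * g \<tau>)"
proof (rule Bochner_Integration.integrable_bound)
  show "integrable N (\<lambda>\<tau>. K * norm (f \<tau>))" using assms(1) by simp
  show "(\<lambda>\<tau>. f \<tau> * g \<tau>) \<in> borel_measurable N"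
    using assms(1,2) by measurable
  have "norm (f \<tau> * g \<tau>) \<le> norm (K * norm (f \<tau>))" for \<tau>
  proof -
    have "norm (f \<tau> * g \<tau>) \<le> norm (f \<tau>) * norm (g \<tau>)" by (rule norm_mult_ineq)
    also have "\<dots> \<le> norm (f \<tau>) * K" using assms(3) by (intro mult_left_mono) auto
    also have "\<dots> \<le> norm (K * norm (f \<tau>))" by (simp add: mult.commute)
    finally show ?thesis .
  qed
  then show "AE \<tau> in N. norm (f \<tau> * g \<tau>) \<le> norm (K * norm (f \<tau>))"
    by simp
qed

lemma ft_measurable:
  assumes [measurable]: "f \<in> borel_measurable borel"
  shows "ft f \<in> borel_measurable borel"
proof -
  have "(\<lambda>\<omega>. CLBINT t. complex_of_real (f t) * cis (- (\<omega> * t))) \<in> borel_measurable borel"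
    by measurable
  then show ?thesis unfolding ft_def[abs_def] .
qed

lemma ft_bound:
  shows "cmod (ft f \<omega>) \<le> (LBINT t. \<bar>f t\<bar>)"
proof -
  have "cmod (ft f \<omega>) \<le> (LBINT t. norm (complex_of_real (f t) * cis (- (\<omega> * t))))"
    unfolding ft_def by (rule integral_norm_bound)
  then show ?thesis by (simp add: norm_mult)
qed

lemma ft_translate: "ft (\<lambda>t. f (t + \<tau>)) \<omega> = cis (\<omega> * \<tau>) * ft f \<omega>"
proof -
  have "ft (\<lambda>t. f (t + \<tau>)) \<omega> = (CLBINT t. complex_of_real (f (t - \<tau> + \<tau>)) * cis (- (\<omega> * (t - \<tau>))))"
    unfolding ft_def by (rule integral_translate[symmetric])
  also have "\<dots> = (CLBINT t. cis (\<omega> * \<tau>) * (complex_of_real (f t) * cis (- (\<omega> * t))))"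
    by (intro Bochner_Integration.integral_cong) (auto simp: cis_mult algebra_simps)
  finally show ?thesis by (simp add: ft_def)
qed

section \<open>Gaussian weights and Fourier inversion\<close>

text \<open>The characteristic function of the standard normal law, evaluated at
  \<open>- \<omega>\<close> because of the sign of the kernel.\<close>

lemma ft_std_normal_density: "ft std_normal_density \<omega> = complex_of_real (exp (- (\<omega>\<^sup>2) / 2))"
proof -
  have "complex_of_real (exp (- ((- \<omega>)\<^sup>2) / 2)) = (CLINT x|std_normal_distribution. iexp ((- \<omega>) * x))"
    using char_std_normal_distribution unfolding char_def by metis
  also have "\<dots> = (CLBINT x. std_normal_density x *\<^sub>R iexp ((- \<omega>) * x))"
    by (rule integral_density) (auto simp: normal_density_nonneg)
  also have "\<dots> = ft std_normal_density \<omega>"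
    by (simp add: ft_def scaleR_conv_of_real cis_conv_exp)
  finally show ?thesis by simp
qed

text \<open>A weight tending to 1 as \<open>e\<close> tends to 0, whose transform is
  \<open>2 * pi\<close> times the normal density of standard deviation \<open>e\<close>, an
  approximate identity.\<close>

definition gauss :: "real \<Rightarrow> real \<Rightarrow> real" where
  "gauss e \<omega> = exp (- ((e * \<omega>)\<^sup>2) / 2)"

lemma gauss_bounds: "0 < gauss e \<omega>" "gauss e \<omega> \<le> 1"
  by (auto simp: gauss_def)

lemma gauss_measurable [measurable]: "gauss e \<in> borel_measurable borel"
  unfolding gauss_def by measurable

lemma gauss_eq_density: "gauss e \<omega> = sqrt (2 * pi) * std_normal_density (e * \<omega>)"
  by (simp add: gauss_def std_normal_density_def)

lemma gauss_integrable: "e > 0 \<Longrightarrow> integrable lborel (gauss e)"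
  using lborel_integrable_real_affine[of std_normal_density e 0]
  by (simp add: gauss_eq_density[abs_def])

lemma ft_gauss:
  assumes "e > 0"
  shows "(CLBINT \<omega>. complex_of_real (gauss e \<omega>) * cis (- (\<omega> * x)))
    = complex_of_real (2 * pi / e * std_normal_density (x / e))"
proof -
  have "(CLBINT \<omega>. complex_of_real (gauss e \<omega>) * cis (- (\<omega> * x)))
      = (CLBINT \<omega>. complex_of_real (sqrt (2 * pi)) *
          (complex_of_real (std_normal_density (0 + e * \<omega>)) * cis (- ((x / e) * (0 + e * \<omega>)))))"
    using assms by (intro Bochner_Integration.integral_cong) (auto simp: gauss_eq_density mult.commute)
  also have "\<dots> = complex_of_real (sqrt (2 * pi)) *
      (CLBINT \<omega>. (complex_of_real (std_normal_density (0 + e * \<omega>)) * cis (- ((x / e) * (0 + e * \<omega>)))))"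
    by (rule integral_mult_right_zero)
  also have "(CLBINT \<omega>. (complex_of_real (std_normal_density (0 + e * \<omega>)) * cis (- ((x / e) * (0 + e * \<omega>)))))
      = (1 / e) *\<^sub>R ft std_normal_density (x / e)"
    unfolding ft_def
    using lborel_integral_real_affine[of e "\<lambda>y. complex_of_real (std_normal_density y) * cis (- ((x / e) * y))" 0] assms
    by simp
  also have "complex_of_real (sqrt (2 * pi)) * ((1 / e) *\<^sub>R ft std_normal_density (x / e))
      = complex_of_real (2 * pi / e * std_normal_density (x / e))"
  proof -
    have "sqrt (2 * pi) * exp (- ((x / e)\<^sup>2) / 2) / e = 2 * pi / e * std_normal_density (x / e)"
    proof -
      \<comment> \<open>Used with \<open>q = sqrt (2 * pi)\<close>: the second factor
        \<open>q\<close> cancels the normalization of the density.\<close>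
      have *: "q * E / e = (q * q) / e * ((1 / q) * E)" if "q > 0" for q E :: real
        using that assms by (simp add: field_simps)
      have "2 * pi = sqrt (2 * pi) * sqrt (2 * pi)" by simp
      then show ?thesis
        unfolding std_normal_density_def using *[of "sqrt (2 * pi)" "exp (- ((x / e)\<^sup>2) / 2)"] pi_gt_zero
        by (metis mult_pos_pos real_sqrt_gt_zero zero_less_numeral)
    qed
    then show ?thesis
      by (simp add: ft_std_normal_density scaleR_conv_of_real flip: of_real_mult of_real_divide)
  qed
  finally show ?thesis .
qed

text \<open>Fubini moves the transform from \<open>r\<close> to the Gaussian weight.\<close>

lemma gauss_weighted_inversion:
  assumes r: "integrable lborel r" and e: "e > 0"
  shows "(CLBINT \<omega>. ft r \<omega> * complex_of_real (gauss e \<omega>))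
    = complex_of_real (2 * pi * (LBINT y. std_normal_density y * r (e * y)))"
proof -
  have [measurable]: "r \<in> borel_measurable borel" using r by simp
  have I: "integrable (lborel \<Otimes>\<^sub>M lborel)
     (\<lambda>(x, \<omega>). complex_of_real (r x) * (complex_of_real (gauss e \<omega>) * cis (- (\<omega> * x))))"
  proof (rule lborel_pair.Fubini_integrable)
    show "(\<lambda>(x, \<omega>). complex_of_real (r x) * (complex_of_real (gauss e \<omega>) * cis (- (\<omega> * x))))
        \<in> borel_measurable (lborel \<Otimes>\<^sub>M lborel)" by measurable
    have "integrable lborel (\<lambda>x. \<bar>r x\<bar> * (LBINT \<omega>. gauss e \<omega>))"
      using r by simp
    then show "integrable lborel (\<lambda>x. LBINT \<omega>. norm (case (x, \<omega>) of (x, \<omega>) \<Rightarrow>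
        complex_of_real (r x) * (complex_of_real (gauss e \<omega>) * cis (- (\<omega> * x)))))"
      by (simp add: norm_mult gauss_bounds less_imp_le)
    show "AE x in lborel. integrable lborel (\<lambda>\<omega>. case (x, \<omega>) of (x, \<omega>) \<Rightarrow>
        complex_of_real (r x) * (complex_of_real (gauss e \<omega>) * cis (- (\<omega> * x))))"
      using gauss_integrable[OF e]
      by (auto intro!: AE_I2 integrable_mult_right integrable_mult_bounded[where K = 1] integrable_of_real)
  qed
  have "(CLBINT \<omega>. ft r \<omega> * complex_of_real (gauss e \<omega>))
      = (CLBINT \<omega>. CLBINT x. complex_of_real (r x) * (complex_of_real (gauss e \<omega>) * cis (- (\<omega> * x))))"
    unfolding ft_def
    by (subst integral_mult_left_zero[symmetric])
      (intro Bochner_Integration.integral_cong refl, simp only: mult_ac)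
  also have "\<dots> = (CLBINT x. CLBINT \<omega>. complex_of_real (r x) * (complex_of_real (gauss e \<omega>) * cis (- (\<omega> * x))))"
    by (rule lborel_pair.Fubini_integral[OF I])
  also have "\<dots> = (CLBINT x. complex_of_real (r x * (2 * pi / e * std_normal_density (x / e))))"
    by (simp add: ft_gauss[OF e])
  also have "\<dots> = complex_of_real (LBINT x. r x * (2 * pi / e * std_normal_density (x / e)))"
    by (rule integral_complex_of_real)
  also have "(LBINT x. r x * (2 * pi / e * std_normal_density (x / e)))
      = e * (LBINT y. r (e * y) * (2 * pi / e * std_normal_density y))"
    using lborel_integral_real_affine[of e "\<lambda>x. r x * (2 * pi / e * std_normal_density (x / e))" 0] e
    by simp
  also have "\<dots> = 2 * pi * (LBINT y. std_normal_density y * r (e * y))"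
    using e by (simp flip: integral_mult_right_zero add: field_simps)
  finally show ?thesis .
qed

lemma gauss_tendsto_1: "(\<lambda>n. gauss (1 / real (Suc n)) \<omega>) \<longlonglongrightarrow> 1"
proof -
  have "(\<lambda>n. 1 / real (Suc n)) \<longlonglongrightarrow> 0"
    using LIMSEQ_inverse_real_of_nat by (simp add: inverse_eq_divide)
  then have "(\<lambda>n. exp (- ((1 / real (Suc n) * \<omega>)\<^sup>2) / 2)) \<longlonglongrightarrow> exp (- ((0 * \<omega>)\<^sup>2) / 2)"
    by (intro tendsto_intros)  auto
  then show ?thesis by (simp add: gauss_def)
qed

text \<open>Shift \<open>\<tau>\<close> to the origin and let the Gaussian weight tend to 1. On the
  frequency side \<open>cmod (ft r \<omega>)\<close> dominates; on the time side the normal averages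
  of the bounded \<open>r\<close> converge to its value at the point of continuity.\<close>

lemma fourier_inversion:
  assumes r: "integrable lborel r" and bd: "\<And>x. \<bar>r x\<bar> \<le> K" and cont: "isCont r \<tau>"
    and ftr: "integrable lborel (ft r)"
  shows "(CLBINT \<omega>. cis (\<omega> * \<tau>) * ft r \<omega>) = complex_of_real (2 * pi * r \<tau>)"
proof -
  have [measurable]: "r \<in> borel_measurable borel" using r by simp
  note [measurable] = ft_measurable[of r]
  let ?r = "\<lambda>x. r (x + \<tau>)" and ?e = "\<lambda>n. 1 / real (Suc n)"
  have r': "integrable lborel ?r"
    using integrable_translate[OF r, of "-\<tau>"] by simp
  have e0: "?e \<longlonglongrightarrow> 0"
    using LIMSEQ_inverse_real_of_nat by (simp add: inverse_eq_divide)
  have L: "(\<lambda>n. CLBINT \<omega>. ft ?r \<omega> * complex_of_real (gauss (?e n) \<omega>)) \<longlonglongrightarrow> (CLBINT \<omega>. ft ?r \<omega> * 1)"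
  proof (rule integral_dominated_convergence[where w = "\<lambda>\<omega>. cmod (ft r \<omega>)"])
    show "AE \<omega> in lborel. (\<lambda>n. ft ?r \<omega> * complex_of_real (gauss (?e n) \<omega>)) \<longlonglongrightarrow> ft ?r \<omega> * 1"
      using gauss_tendsto_1 
      by (intro AE_I2 tendsto_mult_left) (metis of_real_1 tendsto_of_real_iff)
    show "AE \<omega> in lborel. norm (ft ?r \<omega> * complex_of_real (gauss (?e n) \<omega>)) \<le> cmod (ft r \<omega>)" for n
      using gauss_bounds[of "?e n"]
      by (intro AE_I2) (simp add: norm_mult ft_translate mult_left_le less_imp_le)
  qed (use ftr in \<open>auto simp: ft_translate[abs_def]\<close>)
  have "(\<lambda>n. LBINT y. std_normal_density y * ?r (?e n * y)) \<longlonglongrightarrow> (LBINT y. std_normal_density y * r \<tau>)"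
  proof (rule integral_dominated_convergence[where w = "\<lambda>y. std_normal_density y * K"])
    show "AE y in lborel. (\<lambda>n. std_normal_density y * ?r (?e n * y)) \<longlonglongrightarrow> std_normal_density y * r \<tau>"
    proof (intro AE_I2 tendsto_mult_left)
      fix y
      have "(\<lambda>n. ?e n * y + \<tau>) \<longlonglongrightarrow> 0 * y + \<tau>"
        by (intro tendsto_intros e0)
      then show "(\<lambda>n. ?r (?e n * y)) \<longlonglongrightarrow> r \<tau>"
        using isCont_tendsto_compose[OF cont] by simp
    qed
    show "AE y in lborel. norm (std_normal_density y * ?r (?e n * y)) \<le> std_normal_density y * K" for n
      using bd by (intro AE_I2) (auto simp: abs_mult normal_density_nonneg intro!: mult_left_mono)
  qed auto
  then have "(\<lambda>n. complex_of_real (2 * pi * (LBINT y. std_normal_density y * ?r (?e n * y))))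
      \<longlonglongrightarrow> complex_of_real (2 * pi * (LBINT y. std_normal_density y * r \<tau>))"
    by (intro tendsto_of_real tendsto_mult_left)
  moreover have "(CLBINT \<omega>. ft ?r \<omega> * complex_of_real (gauss (?e n) \<omega>))
      = complex_of_real (2 * pi * (LBINT y. std_normal_density y * ?r (?e n * y)))" for n
    by (rule gauss_weighted_inversion[OF r']) simp
  ultimately have "(CLBINT \<omega>. ft ?r \<omega> * 1) = complex_of_real (2 * pi * (LBINT y. std_normal_density y * r \<tau>))"
    using L by (simp only:) (rule LIMSEQ_unique)
  then show ?thesis by (simp add: ft_translate)
qed

section \<open>Transforms of correlations and square-integrability\<close>

text \<open>Fubini after the substitution \<open>s = t - x\<close>. The reflection of
  \<open>a\<close> in this substitution produces the conjugate, because \<open>a\<close> is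
  real.\<close>

lemma ft_corr:
  assumes a: "integrable lborel a" and b: "integrable lborel b"
  shows "integrable lborel (corr a b)" and "ft (corr a b) \<omega> = ft b \<omega> * cnj (ft a \<omega>)"
proof -
  have [measurable]: "a \<in> borel_measurable borel" "b \<in> borel_measurable borel" using a b by auto
  have I: "integrable (lborel \<Otimes>\<^sub>M lborel)
     (\<lambda>(t, x). complex_of_real (a (t - x) * b t) * cis (- (\<omega> * x)))" for \<omega>
  proof (rule lborel_pair.Fubini_integrable)
    show "(\<lambda>(t, x). complex_of_real (a (t - x) * b t) * cis (- (\<omega> * x)))
        \<in> borel_measurable (lborel \<Otimes>\<^sub>M lborel)" by measurable
    have "(LBINT x. \<bar>a (t - x)\<bar>) = (LBINT s. \<bar>a s\<bar>)" for t
      using lborel_integral_real_affine[of "-1" "\<lambda>s. \<bar>a s\<bar>" t] by simp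
    moreover have "integrable lborel (\<lambda>t. \<bar>b t\<bar> * (LBINT s. \<bar>a s\<bar>))"
      using b by simp
    ultimately show "integrable lborel (\<lambda>t. LBINT x. norm (case (t, x) of (t, x) \<Rightarrow>
        complex_of_real (a (t - x) * b t) * cis (- (\<omega> * x))))"
      by (simp add: norm_mult abs_mult mult.commute)
    have "integrable lborel (\<lambda>x. a (t - x))" for t
      using lborel_integrable_real_affine[OF a, of "-1" t] by simp
    then have "integrable lborel (\<lambda>x. complex_of_real (a (t - x) * b t) * cis (- (\<omega> * x)))" for t
      by (intro integrable_mult_bounded[where K = 1 and f = "\<lambda>x. complex_of_real (a (t - x) * b t)"]
          integrable_of_real integrable_mult_left) auto
    then show "AE t in lborel. integrable lborel (\<lambda>x. case (t, x) of (t, x) \<Rightarrow>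
        complex_of_real (a (t - x) * b t) * cis (- (\<omega> * x)))"
      by simp
  qed
  have c: "(CLBINT t. complex_of_real (a (t - x) * b t) * cis (- (\<omega> * x)))
      = complex_of_real (corr a b x) * cis (- (\<omega> * x))" for x \<omega>
  proof -
    have "(CLBINT t. complex_of_real (a (t - x) * b t) * cis (- (\<omega> * x)))
       = (CLBINT t. complex_of_real (a (t - x) * b t)) * cis (- (\<omega> * x))"
      by (rule integral_mult_left_zero)
    then show ?thesis by (simp only: integral_complex_of_real corr_def ip_def)
  qed
  \<comment> \<open>At frequency 0 the phase is 1, so product integrability yields integrability of
    the correlation itself.\<close>
  have "integrable lborel (\<lambda>x. CLBINT t. complex_of_real (a (t - x) * b t) * cis (- (0 * x)))"
    using lborel_pair.integrable_snd[OF I[of 0]] by simp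
  then have "integrable lborel (\<lambda>x. complex_of_real (corr a b x))"
    unfolding c by simp
  then show "integrable lborel (corr a b)"
    by (simp add: complex_of_real_integrable_eq)
  have inner: "(CLBINT x. complex_of_real (a (t - x) * b t) * cis (- (\<omega> * x)))
      = complex_of_real (b t) * cis (- (\<omega> * t)) * cnj (ft a \<omega>)" for t
  proof -
    have "(CLBINT x. complex_of_real (a (t - x) * b t) * cis (- (\<omega> * x)))
       = (CLBINT s. complex_of_real (a s * b t) * cis (- (\<omega> * (t - s))))"
      using lborel_integral_real_affine[of "-1" "\<lambda>s. complex_of_real (a s * b t) * cis (- (\<omega> * (t - s)))" t]
      by simp
    also have "\<dots> = (CLBINT s. complex_of_real (b t) * cis (- (\<omega> * t)) * cnj (complex_of_real (a s) * cis (- (\<omega> * s))))"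
      by (intro Bochner_Integration.integral_cong) (auto simp: cis_mult cis_cnj algebra_simps)
    also have "\<dots> = complex_of_real (b t) * cis (- (\<omega> * t)) * cnj (ft a \<omega>)"
      unfolding ft_def by (simp only: integral_mult_right_zero Bochner_Integration.integral_cnj)
    finally show ?thesis .
  qed
  have "ft (corr a b) \<omega> = (CLBINT x. CLBINT t. complex_of_real (a (t - x) * b t) * cis (- (\<omega> * x)))"
    unfolding c ft_def ..
  also have "\<dots> = (CLBINT t. CLBINT x. complex_of_real (a (t - x) * b t) * cis (- (\<omega> * x)))"
    by (rule lborel_pair.Fubini_integral[OF I])
  also have "\<dots> = (CLBINT t. complex_of_real (b t) * cis (- (\<omega> * t)) * cnj (ft a \<omega>))"
    unfolding inner ..
  also have "\<dots> = ft b \<omega> * cnj (ft a \<omega>)"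
    unfolding ft_def by (rule integral_mult_left_zero)
  finally show "ft (corr a b) \<omega> = ft b \<omega> * cnj (ft a \<omega>)" .
qed

text \<open>The Gaussian-weighted energy of \<open>ft a\<close> is \<open>2 * pi\<close> times a
  normal average of the autocorrelation, which never exceeds \<open>ip a a\<close>. Fatou's lemma
  removes the weight.\<close>

lemma ft_L2:
  assumes a: "integrable lborel a" and a2: "a \<in> L2"
  shows "(\<lambda>\<omega>. cmod (ft a \<omega>)) \<in> L2"
proof (rule L2_I)
  have [measurable]: "a \<in> borel_measurable borel" using a by auto
  note [measurable] = ft_measurable[of a]
  let ?e = "\<lambda>n. 1 / real (Suc n)" and ?r = "corr a a"
  have [measurable]: "?r \<in> borel_measurable borel" by (rule corr_measurable) auto
  show "(\<lambda>\<omega>. cmod (ft a \<omega>)) \<in> borel_measurable borel" by measurable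
  have rle: "\<bar>?r x\<bar> \<le> ip a a" for x
    using corr_le[OF a2 a2, of x] by (simp add: L2_norm_power2[symmetric] power2_eq_square)
  have ftr: "ft ?r \<omega> = complex_of_real ((cmod (ft a \<omega>))\<^sup>2)" for \<omega>
    unfolding ft_corr(2)[OF a a] by (rule complex_norm_square[symmetric])
  have fin: "(\<integral>\<^sup>+\<omega>. ennreal ((cmod (ft a \<omega>))\<^sup>2 * gauss (?e n) \<omega>) \<partial>lborel) \<le> ennreal (2 * pi * ip a a)" for n
  proof -
    have i: "integrable lborel (\<lambda>\<omega>. (cmod (ft a \<omega>))\<^sup>2 * gauss (?e n) \<omega>)"
      unfolding mult.commute[of "_\<^sup>2"]
      by (rule integrable_mult_bounded[OF gauss_integrable, where K = "(LBINT t. \<bar>a t\<bar>)\<^sup>2"])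
        (auto intro!: power_mono ft_bound)
    have "complex_of_real (LBINT \<omega>. (cmod (ft a \<omega>))\<^sup>2 * gauss (?e n) \<omega>)
        = complex_of_real (2 * pi * (LBINT y. std_normal_density y * ?r (?e n * y)))"
      using gauss_weighted_inversion[OF ft_corr(1)[OF a a], of "?e n"]
      unfolding ftr of_real_mult[symmetric] integral_complex_of_real by simp
    then have "(LBINT \<omega>. (cmod (ft a \<omega>))\<^sup>2 * gauss (?e n) \<omega>) = 2 * pi * (LBINT y. std_normal_density y * ?r (?e n * y))"
      using of_real_eq_iff by blast
    also have "(LBINT y. std_normal_density y * ?r (?e n * y)) \<le> (LBINT y. std_normal_density y * ip a a)"
    proof (rule integral_mono)
      show "integrable lborel (\<lambda>y. std_normal_density y * ?r (?e n * y))"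
        by (rule integrable_mult_bounded[where K = "ip a a"]) (use rle in auto)
      show "std_normal_density y * ?r (?e n * y) \<le> std_normal_density y * ip a a" for y
        using rle[of "?e n * y"] by (intro mult_left_mono) (auto simp: normal_density_nonneg)
    qed simp
    finally have "(LBINT \<omega>. (cmod (ft a \<omega>))\<^sup>2 * gauss (?e n) \<omega>) \<le> 2 * pi * ip a a" by simp
    then show ?thesis
      using i gauss_bounds[of "?e n"] by (subst nn_integral_eq_integral) (auto simp: less_imp_le ennreal_leI)
  qed
  have "(\<integral>\<^sup>+\<omega>. ennreal ((cmod (ft a \<omega>))\<^sup>2) \<partial>lborel)
      = (\<integral>\<^sup>+\<omega>. liminf (\<lambda>n. ennreal ((cmod (ft a \<omega>))\<^sup>2 * gauss (?e n) \<omega>)) \<partial>lborel)"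
  proof (intro nn_integral_cong)
    fix \<omega>
    have "(\<lambda>n. (cmod (ft a \<omega>))\<^sup>2 * gauss (?e n) \<omega>) \<longlonglongrightarrow> (cmod (ft a \<omega>))\<^sup>2 * 1"
      by (intro tendsto_mult_left gauss_tendsto_1)
    then have "(\<lambda>n. ennreal ((cmod (ft a \<omega>))\<^sup>2 * gauss (?e n) \<omega>)) \<longlonglongrightarrow> ennreal ((cmod (ft a \<omega>))\<^sup>2 * 1)"
      by (rule tendsto_ennrealI)
    then show "ennreal ((cmod (ft a \<omega>))\<^sup>2) = liminf (\<lambda>n. ennreal ((cmod (ft a \<omega>))\<^sup>2 * gauss (?e n) \<omega>))"
      using lim_imp_Liminf[OF trivial_limit_sequentially] by fastforce
  qed
  also have "\<dots> \<le> liminf (\<lambda>n. \<integral>\<^sup>+\<omega>. ennreal ((cmod (ft a \<omega>))\<^sup>2 * gauss (?e n) \<omega>) \<partial>lborel)"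
    by (rule nn_integral_liminf) measurable
  also have "\<dots> \<le> liminf (\<lambda>n. ennreal (2 * pi * ip a a))"
    by (rule Liminf_mono) (use fin in simp)
  also have "\<dots> < \<infinity>" by (simp add: Liminf_const)
  finally show "integrable lborel (\<lambda>\<omega>. (cmod (ft a \<omega>))\<^sup>2)"
    by (intro integrableI_bounded) auto
qed

section \<open>Continuous approximation and continuity of translation in mean square\<close>

lemma indicator_interval_integrable: "integrable lborel (\<lambda>t. K * indicator {a..b::real} t :: real)"
  by (intro integrable_mult_right integrable_real_indicator)
    (simp, metis bounded_closed_interval emeasure_bounded_finite infinity_ennreal_def)

lemma square_le_squareI: "\<bar>x\<bar> \<le> C \<Longrightarrow> x\<^sup>2 \<le> (C::real)\<^sup>2"
  by (metis power2_abs power_mono abs_ge_zero)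

lemma L2_bounded_support:
  assumes "b \<in> borel_measurable borel" "\<And>t. \<bar>b t\<bar> \<le> C" "\<And>t. \<bar>t\<bar> > S \<Longrightarrow> b t = 0"
  shows "b \<in> L2" and "integrable lborel b"
proof -
  have *: "\<bar>b t\<bar> \<le> \<bar>C\<bar>" for t using assms(2)[of t] by linarith
  have "norm (b t) \<le> norm (C * indicator {-S..S} t)" for t
    using *[of t] assms(3)[of t] by (auto simp: indicator_def not_le)
  then show "integrable lborel b"
    using assms(1) by (intro Bochner_Integration.integrable_bound[OF indicator_interval_integrable[of C "-S" S]]) auto
  have "norm ((b t)\<^sup>2) \<le> norm (C\<^sup>2 * indicator {-S..S} t)" for t
    using square_le_squareI[OF assms(2), of t] assms(3)[of t] by (auto simp: indicator_def not_le)
  then have "integrable lborel (\<lambda>t. (b t)\<^sup>2)"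
    using assms(1) by (intro Bochner_Integration.integrable_bound[OF indicator_interval_integrable[of "C\<^sup>2" "-S" S]]) auto
  then show "b \<in> L2" by (rule L2_I[OF assms(1)])
qed

lemma L2_norm_tendsto_0:
  assumes "\<And>n. f n \<in> borel_measurable borel" "integrable lborel w"
    and "AE t in lborel. (\<lambda>n. f n t) \<longlonglongrightarrow> 0" "\<And>n t. (f n t)\<^sup>2 \<le> w t"
  shows "(\<lambda>n. L2_norm (f n)) \<longlonglongrightarrow> 0"
proof -
  have m: "(\<lambda>t. (f n t)\<^sup>2) \<in> borel_measurable lborel" for n
    using assms(1)[of n] by measurable
  have "(\<lambda>n. LBINT t. (f n t)\<^sup>2) \<longlonglongrightarrow> (LBINT t::real. (0::real))"
  proof (rule integral_dominated_convergence[where w = w])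
    show "AE t in lborel. (\<lambda>n. (f n t)\<^sup>2) \<longlonglongrightarrow> 0"
      using assms(3) by eventually_elim (rule tendsto_eq_intros | simp)+
  qed (use m assms in auto)
  then show ?thesis
    unfolding L2_norm_def using tendsto_real_sqrt by fastforce
qed

text \<open>Measurability supplies continuous functions converging to \<open>b\<close> off a null
  set. Clipping them to \<open>[-C, C]\<close> and multiplying by a bump gives a common bound and a
  common support, so the convergence also holds in mean square.\<close>

lemma continuous_approx_L2:
  assumes b: "b \<in> borel_measurable borel" "\<And>t. \<bar>b t\<bar> \<le> C" "\<And>t. \<bar>t\<bar> > S \<Longrightarrow> b t = 0"
    and e: "e > 0"
  obtains g where "continuous_on UNIV g" "\<And>t. \<bar>g t\<bar> \<le> C" "\<And>t. \<bar>t\<bar> > S + 1 \<Longrightarrow> g t = 0"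
    "L2_norm (\<lambda>t. b t - g t) < e"
proof -
  have C: "0 \<le> C" using b(2) abs_ge_zero order_trans by blast
  have "b measurable_on UNIV"
    using b(1) by (intro lebesgue_measurable_imp_measurable_on_real measurable_completion) auto
  then obtain N g where N: "negligible N" and g: "\<And>n::nat. continuous_on UNIV (g n)"
    and lim: "\<And>x. x \<notin> N \<Longrightarrow> (\<lambda>n. g n x) \<longlonglongrightarrow> b x"
    unfolding measurable_on_def by auto
  define bump where "bump t = max 0 (min 1 (S + 1 - \<bar>t\<bar>))" for t :: real
  define h where "h n t = bump t * max (- C) (min C (g n t))" for n t
  have bump: "0 \<le> bump t" "bump t \<le> 1" "\<bar>t\<bar> > S + 1 \<Longrightarrow> bump t = 0" "\<bar>t\<bar> \<le> S \<Longrightarrow> bump t = 1" for t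
    by (auto simp: bump_def)
  have hc: "continuous_on UNIV (h n)" for n
    unfolding h_def bump_def by (intro continuous_intros g)
  have hb: "\<bar>h n t\<bar> \<le> C" for n t
  proof -
    have "\<bar>h n t\<bar> \<le> 1 * C"
      unfolding h_def abs_mult using bump[of t] C by (intro mult_mono) auto
    then show ?thesis by simp
  qed
  have h0: "\<bar>t\<bar> > S + 1 \<Longrightarrow> h n t = 0" for n t
    by (simp add: h_def bump)
  \<comment> \<open>Negligibility refers to the completed measure and is transferred back to
    \<open>lborel\<close>.\<close>
  have AEN: "AE t in lborel. t \<notin> N"
    using N AE_not_in[of N lebesgue] AE_completion_iff[of "\<lambda>t. t \<notin> N" lborel]
    by (simp add: negligible_iff_null_sets)
  have "(\<lambda>n. L2_norm (\<lambda>t. b t - h n t)) \<longlonglongrightarrow> 0"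
  proof (rule L2_norm_tendsto_0[where w = "\<lambda>t. (2 * C)\<^sup>2 * indicator {- (S + 1)..S + 1} t"])
    show "(\<lambda>t. b t - h n t) \<in> borel_measurable borel" for n
      using b(1) borel_measurable_continuous_onI[OF hc[of n]] by measurable
    show "AE t in lborel. (\<lambda>n. b t - h n t) \<longlonglongrightarrow> 0"
      using AEN
    proof eventually_elim
      fix t assume "t \<notin> N"
      then have "(\<lambda>n. b t - h n t) \<longlonglongrightarrow> b t - bump t * max (- C) (min C (b t))"
        unfolding h_def by (intro tendsto_intros lim)
      \<comment> \<open>Clipping and the bump leave \<open>b\<close> itself unchanged, so the
        modified sequence has the same limit.\<close>
      moreover have "bump t * max (- C) (min C (b t)) = b t"
        using b(2)[of t] b(3)[of t] bump(4)[of t] by (cases "\<bar>t\<bar> \<le> S") (auto simp: not_le)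
      ultimately show "(\<lambda>n. b t - h n t) \<longlonglongrightarrow> 0" by simp
    qed
    show "(b t - h n t)\<^sup>2 \<le> (2 * C)\<^sup>2 * indicator {- (S + 1)..S + 1} t" for n t
    proof (cases "\<bar>t\<bar> \<le> S + 1")
      case True
      have "\<bar>b t - h n t\<bar> \<le> 2 * C" using b(2)[of t] hb[of n t] by linarith
      then have "(b t - h n t)\<^sup>2 \<le> (2 * C)\<^sup>2" by (rule square_le_squareI)
      then show ?thesis using True by (auto simp: indicator_def)
    next
      case False
      then show ?thesis using b(3)[of t] h0[of t n] by auto
    qed
  qed (rule indicator_interval_integrable)
  then have "\<forall>\<^sub>F n in sequentially. L2_norm (\<lambda>t. b t - h n t) < e"
    using e by (rule order_tendstoD)
  then obtain n where "L2_norm (\<lambda>t. b t - h n t) < e"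
    by (meson eventually_sequentially order_refl)
  then show thesis using that[of "h n"] hc hb h0 by blast
qed

text \<open>An \<open>e / 3\<close> argument: replacing \<open>b\<close> by a continuous
  \<open>g\<close> costs the same error before and after translation, and translates of
  \<open>g\<close> converge by dominated convergence.\<close>

lemma L2_translation_continuous:
  assumes b: "b \<in> borel_measurable borel" "\<And>t. \<bar>b t\<bar> \<le> C" "\<And>t. \<bar>t\<bar> > S \<Longrightarrow> b t = 0"
    and X: "X \<longlonglongrightarrow> 0"
  shows "(\<lambda>n. L2_norm (\<lambda>t. b (t + X n) - b t)) \<longlonglongrightarrow> 0"
proof (rule LIMSEQ_I)
  fix e :: real assume "e > 0"
  then have e3: "e / 3 > 0" by simp
  obtain g where g: "continuous_on UNIV g" "\<And>t. \<bar>g t\<bar> \<le> C" "\<And>t. \<bar>t\<bar> > S + 1 \<Longrightarrow> g t = 0"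
    and bg: "L2_norm (\<lambda>t. b t - g t) < e / 3"
    using continuous_approx_L2[OF b e3] by blast
  have C: "0 \<le> C" using b(2) abs_ge_zero order_trans by blast
  have gm [measurable]: "g \<in> borel_measurable borel"
    using g(1) by (rule borel_measurable_continuous_onI)
  note b(1)[measurable]
  \<comment> \<open>A bound on all shifts, so that one interval contains the supports of all
    translates of \<open>g\<close>.\<close>
  obtain D where D: "\<And>n. \<bar>X n\<bar> \<le> D"
    using convergent_imp_Bseq[OF convergentI[OF X]] by (auto simp: Bseq_def)
  have "(\<lambda>n. L2_norm (\<lambda>t. g (t + X n) - g t)) \<longlonglongrightarrow> 0"
  proof (rule L2_norm_tendsto_0[where w = "\<lambda>t. (2 * C)\<^sup>2 * indicator {- (S + 1 + D)..S + 1 + D} t"])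
    show "(\<lambda>t. g (t + X n) - g t) \<in> borel_measurable borel" for n by measurable
    show "AE t in lborel. (\<lambda>n. g (t + X n) - g t) \<longlonglongrightarrow> 0"
    proof (rule AE_I2)
      fix t
      have "(\<lambda>n. t + X n) \<longlonglongrightarrow> t + 0" by (intro tendsto_intros X)
      moreover have "isCont g t" using g(1) by (simp add: continuous_on_eq_continuous_at)
      ultimately have "(\<lambda>n. g (t + X n)) \<longlonglongrightarrow> g t" using isCont_tendsto_compose by fastforce
      then show "(\<lambda>n. g (t + X n) - g t) \<longlonglongrightarrow> 0"
        using LIM_zero by blast
    qed
    show "(g (t + X n) - g t)\<^sup>2 \<le> (2 * C)\<^sup>2 * indicator {- (S + 1 + D)..S + 1 + D} t" for n t
    proof (cases "\<bar>t\<bar> \<le> S + 1 + D")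
      case True
      have "\<bar>g (t + X n) - g t\<bar> \<le> 2 * C" using g(2)[of t] g(2)[of "t + X n"] by linarith
      then have "(g (t + X n) - g t)\<^sup>2 \<le> (2 * C)\<^sup>2" by (rule square_le_squareI)
      then show ?thesis using True by (auto simp: indicator_def)
    next
      case False
      then have "\<bar>t\<bar> > S + 1" "\<bar>t + X n\<bar> > S + 1" using D[of n] by linarith+
      then show ?thesis using g(3) by simp
    qed
  qed (rule indicator_interval_integrable)
  then have "\<forall>\<^sub>F n in sequentially. L2_norm (\<lambda>t. g (t + X n) - g t) < e / 3"
    using e3 by (rule order_tendstoD)
  then obtain n0 where n0: "\<And>n. n \<ge> n0 \<Longrightarrow> L2_norm (\<lambda>t. g (t + X n) - g t) < e / 3"
    unfolding eventually_sequentially by blast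
  have bL: "b \<in> L2" using L2_bounded_support[OF b] by simp
  have gL: "g \<in> L2" using L2_bounded_support[OF gm g(2,3)] by simp
  have "norm (L2_norm (\<lambda>t. b (t + X n) - b t) - 0) < e" if "n \<ge> n0" for n
  proof -
    let ?p = "\<lambda>t. b (t + X n) - g (t + X n)" and ?q = "\<lambda>t. g (t + X n) - g t" and ?r = "\<lambda>t. g t - b t"
    have p: "?p \<in> L2" "L2_norm ?p = L2_norm (\<lambda>t. b t - g t)"
      using L2_translate[OF L2_diff[OF bL gL], of "- X n"] L2_norm_translate[of "\<lambda>t. b t - g t" "- X n"]
      by simp_all
    have q: "?q \<in> L2" using L2_diff[OF L2_translate[OF gL, of "- X n"] gL] by simp
    have r: "?r \<in> L2" "L2_norm ?r = L2_norm (\<lambda>t. b t - g t)"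
      using L2_diff[OF gL bL] by (auto simp: L2_norm_def power2_commute)
    have "L2_norm (\<lambda>t. b (t + X n) - b t) = L2_norm (\<lambda>t. (?p t + ?q t) + ?r t)" by simp
    also have "\<dots> \<le> L2_norm (\<lambda>t. ?p t + ?q t) + L2_norm ?r"
      by (rule L2_norm_add_le[OF L2_add[OF p(1) q] r(1)])
    also have "\<dots> \<le> L2_norm ?p + L2_norm ?q + L2_norm ?r"
      using L2_norm_add_le[OF p(1) q] by simp
    also have "\<dots> < e" using p(2) r(2) bg n0[OF that] by simp
    finally show ?thesis by (simp add: L2_norm_nonneg)
  qed
  then show "\<exists>n0. \<forall>n\<ge>n0. norm (L2_norm (\<lambda>t. b (t + X n) - b t) - 0) < e" by blast
qed

text \<open>The shift is moved onto \<open>b\<close>, whose translates vary continuously in mean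
  square; Cauchy-Schwarz absorbs the arbitrary \<open>a\<close>.\<close>

lemma corr_continuous:
  assumes a: "a \<in> L2"
    and b: "b \<in> borel_measurable borel" "\<And>t. \<bar>b t\<bar> \<le> C" "\<And>t. \<bar>t\<bar> > S \<Longrightarrow> b t = 0"
  shows "isCont (corr a b) \<tau>"
  unfolding continuous_at_sequentially o_def
proof (intro allI impI)
  fix Y assume Y: "Y \<longlonglongrightarrow> \<tau>"
  let ?X = "\<lambda>n. Y n - \<tau>"
  have X0: "?X \<longlonglongrightarrow> 0" using Y LIM_zero by blast
  have bL: "b \<in> L2" using L2_bounded_support[OF b] by simp
  have corr_eq: "corr a b y = ip a (\<lambda>t. b (t + y))" for y
    unfolding corr_def ip_def using integral_translate[of "\<lambda>t. a t * b (t + y)" y] by simp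
  have bt: "(\<lambda>t. b (t + y)) \<in> L2" for y using L2_translate[OF bL, of "-y"] by simp
  have "\<bar>corr a b (Y n) - corr a b \<tau>\<bar> \<le> L2_norm a * L2_norm (\<lambda>t. b (t + ?X n) - b t)" for n
  proof -
    have "corr a b (Y n) - corr a b \<tau> = ip a (\<lambda>t. b (t + Y n) - b (t + \<tau>))"
      unfolding corr_eq ip_commute[of a] using ip_diff_left[OF bt bt a] by simp
    then have "\<bar>corr a b (Y n) - corr a b \<tau>\<bar> \<le> L2_norm a * L2_norm (\<lambda>t. b (t + Y n) - b (t + \<tau>))"
      using Cauchy_Schwarz_L2[OF a L2_diff[OF bt bt]] by simp
    moreover have "L2_norm (\<lambda>t. b (t + Y n) - b (t + \<tau>)) = L2_norm (\<lambda>t. b (t + ?X n) - b t)"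
      using L2_norm_translate[of "\<lambda>t. b (t + ?X n) - b t" "-\<tau>"] by (simp add: algebra_simps)
    ultimately show ?thesis by simp
  qed
  moreover have "(\<lambda>n. L2_norm a * L2_norm (\<lambda>t. b (t + ?X n) - b t)) \<longlonglongrightarrow> 0"
    by (rule tendsto_mult_right_zero) (rule L2_translation_continuous[OF b X0])
  ultimately have "(\<lambda>n. corr a b (Y n) - corr a b \<tau>) \<longlonglongrightarrow> 0"
    by (intro Lim_null_comparison[where f = "\<lambda>n. corr a b (Y n) - corr a b \<tau>"]) (auto intro!: always_eventually)
  then show "(\<lambda>n. corr a b (Y n)) \<longlonglongrightarrow> corr a b \<tau>"
    by (rule LIM_zero_cancel)
qed

section \<open>Parseval's identity\<close>

lemma integrable_mult_L2_complex:
  fixes F G :: "real \<Rightarrow> complex"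
  assumes "(\<lambda>\<omega>. cmod (F \<omega>)) \<in> L2" "(\<lambda>\<omega>. cmod (G \<omega>)) \<in> L2"
    and "F \<in> borel_measurable borel" "G \<in> borel_measurable borel"
  shows "integrable lborel (\<lambda>\<omega>. F \<omega> * G \<omega>)"
  using assms(3,4)
  by (intro Bochner_Integration.integrable_bound[OF L2_mult_integrable[OF assms(1,2)]])
    (auto simp: norm_mult)

text \<open>Fourier inversion for \<open>corr a b\<close>, which is integrable, bounded and
  continuous, and whose transform is integrable as a product of two square-integrable
  functions.\<close>

lemma parseval:
  assumes a: "a \<in> L2" "integrable lborel a"
    and b: "b \<in> borel_measurable borel" "\<And>t. \<bar>b t\<bar> \<le> C" "\<And>t. \<bar>t\<bar> > S \<Longrightarrow> b t = 0"
  shows "integrable lborel (\<lambda>\<omega>. ft b \<omega> * cnj (ft a \<omega>))"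
    and "(CLBINT \<omega>. cis (\<omega> * \<tau>) * (ft b \<omega> * cnj (ft a \<omega>))) = complex_of_real (2 * pi * corr a b \<tau>)"
proof -
  have bL: "b \<in> L2" "integrable lborel b"
    using L2_bounded_support[OF b] by auto
  have m: "ft a \<in> borel_measurable borel" "ft b \<in> borel_measurable borel"
    using a b(1) by (auto intro!: ft_measurable)
  show i: "integrable lborel (\<lambda>\<omega>. ft b \<omega> * cnj (ft a \<omega>))"
    using ft_L2[OF a(2,1)] ft_L2[OF bL(2,1)] m(2) measurable_compose[OF m(1) cnj_measurable]
    by (intro integrable_mult_L2_complex) auto
  show "(CLBINT \<omega>. cis (\<omega> * \<tau>) * (ft b \<omega> * cnj (ft a \<omega>))) = complex_of_real (2 * pi * corr a b \<tau>)"
    using fourier_inversion[OF ft_corr(1)[OF a(2) bL(2)] corr_le[OF a(1) bL(1)] corr_continuous[OF a(1) b]]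
      i unfolding ft_corr(2)[OF a(2) bL(2), abs_def] ft_corr(2)[OF a(2) bL(2)] by simp
qed

section \<open>The frequency-domain inequality\<close>

abbreviation restr :: "real \<Rightarrow> signal \<Rightarrow> signal" where
  "restr R x \<equiv> (\<lambda>t. if \<bar>t\<bar> \<le> R then x t else 0)"

lemma set_integral_eq_ft_restr:
  "(CLBINT t:{-R..R}. complex_of_real (u t) * cis (- (\<omega> * t))) = ft (restr R u) \<omega>"
  unfolding set_lebesgue_integral_def ft_def
  by (intro Bochner_Integration.integral_cong) (auto simp: indicator_def)

lemma restr_L2:
  assumes "x \<in> L2"
  shows "restr R x \<in> L2"
proof (rule L2_bound[OF _ assms])
  have [measurable]: "x \<in> borel_measurable borel" using assms by (rule L2_measurable)
  show "restr R x \<in> borel_measurable borel" by measurable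
qed auto

lemma restr_integrable:
  assumes "x \<in> L2"
  shows "integrable lborel (restr R x)"
proof -
  have "(\<lambda>t. if \<bar>t\<bar> \<le> R then 1 else 0 :: real) \<in> L2"
    by (rule L2_bounded_support[where C = 1 and S = R]) auto
  from L2_mult_integrable[OF assms this] show ?thesis
    by (rule Bochner_Integration.integrable_cong[THEN iffD1, rotated 2]) auto
qed

lemma is_fourier_bounded_support:
  assumes b: "b \<in> borel_measurable borel" "\<And>t. \<bar>b t\<bar> \<le> C" "\<And>t. \<bar>t\<bar> > S \<Longrightarrow> b t = 0"
  shows "is_fourier b (ft b)"
  unfolding is_fourier_def set_integral_eq_ft_restr
proof
  show "ft b \<in> borel_measurable borel" using b(1) by (rule ft_measurable)
  have "\<forall>\<^sub>F R in at_top. (\<integral>\<^sup>+\<omega>. ennreal ((cmod (ft b \<omega> - ft (restr R b) \<omega>))\<^sup>2) \<partial>lborel) = 0"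
    using eventually_ge_at_top[of S]
  proof eventually_elim
    fix R assume "R \<ge> S"
    then have "restr R b = b" using b(3) by (auto simp: fun_eq_iff)
    then show "(\<integral>\<^sup>+\<omega>. ennreal ((cmod (ft b \<omega> - ft (restr R b) \<omega>))\<^sup>2) \<partial>lborel) = 0" by simp
  qed
  then show "((\<lambda>R. \<integral>\<^sup>+\<omega>. ennreal ((cmod (ft b \<omega> - ft (restr R b) \<omega>))\<^sup>2) \<partial>lborel) \<longlongrightarrow> 0) at_top"
    by (rule tendsto_eventually)
qed

text \<open>Since \<open>b\<close> has bounded support, the correlation of \<open>restr R x\<close>
  with \<open>b\<close> at a fixed lag already equals that of \<open>x\<close> once \<open>R\<close>
  is large. Only the frequency side passes to a limit, with an error controlled by
  Cauchy-Schwarz.\<close>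

lemma parseval_is_fourier:
  assumes x: "x \<in> L2" "is_fourier x X"
    and b: "b \<in> borel_measurable borel" "\<And>t. \<bar>b t\<bar> \<le> C" "\<And>t. \<bar>t\<bar> > S \<Longrightarrow> b t = 0"
  shows "integrable lborel (\<lambda>\<omega>. ft b \<omega> * cnj (X \<omega>))"
    and "(CLBINT \<omega>. cis (\<omega> * \<tau>) * (ft b \<omega> * cnj (X \<omega>))) = complex_of_real (2 * pi * corr x b \<tau>)"
proof -
  have bL: "b \<in> L2" "integrable lborel b" using L2_bounded_support[where C = C and S = S, OF b] by auto
  have X [measurable]: "X \<in> borel_measurable borel" using x(2) by (simp add: is_fourier_def)
  have B [measurable]: "ft b \<in> borel_measurable borel" using b(1) by (rule ft_measurable)
  have BL: "(\<lambda>\<omega>. cmod (ft b \<omega>)) \<in> L2" by (rule ft_L2[OF bL(2,1)])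
  define D where "D R \<omega> = cmod (X \<omega> - ft (restr R x) \<omega>)" for R \<omega>
  have XR [measurable]: "ft (restr R x) \<in> borel_measurable borel" for R
    using L2_measurable[OF restr_L2[OF x(1)]] by (rule ft_measurable)
  have Dm [measurable]: "D R \<in> borel_measurable borel" for R unfolding D_def by measurable
  have lim: "((\<lambda>R. \<integral>\<^sup>+\<omega>. ennreal ((D R \<omega>)\<^sup>2) \<partial>lborel) \<longlongrightarrow> 0) at_top"
    using x(2) unfolding is_fourier_def set_integral_eq_ft_restr D_def by simp
  have DL: "D R \<in> L2" "L2_norm (D R) < e"
    if "e > 0" "(\<integral>\<^sup>+\<omega>. ennreal ((D R \<omega>)\<^sup>2) \<partial>lborel) < ennreal (e\<^sup>2)" for R e
  proof -
    have i: "integrable lborel (\<lambda>\<omega>. (D R \<omega>)\<^sup>2)"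
      using that(2) by (intro integrableI_bounded) (auto intro: order.strict_trans)
    then show "D R \<in> L2" by (intro L2_I Dm)
    have "ennreal (LBINT \<omega>. (D R \<omega>)\<^sup>2) < ennreal (e\<^sup>2)"
      using that(2) nn_integral_eq_integral[OF i] by simp
    then have "(LBINT \<omega>. (D R \<omega>)\<^sup>2) < e\<^sup>2"
      by (subst (asm) ennreal_less_iff) (auto intro!: Bochner_Integration.integral_nonneg)
    then show "L2_norm (D R) < e"
      unfolding L2_norm_def using that(1) real_sqrt_less_mono by fastforce
  qed
  have ev: "\<forall>\<^sub>F R in at_top. D R \<in> L2 \<and> L2_norm (D R) < e" if "e > 0" for e
  proof -
    have "\<forall>\<^sub>F R in at_top. (\<integral>\<^sup>+\<omega>. ennreal ((D R \<omega>)\<^sup>2) \<partial>lborel) < ennreal (e\<^sup>2)"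
      using that by (intro order_tendstoD(2)[OF lim]) simp
    then show ?thesis by eventually_elim (use DL[OF that] in blast)
  qed
  note pR = parseval[where C = C and S = S, OF restr_L2[OF x(1)] restr_integrable[OF x(1)] b]
  have split: "ft b \<omega> * cnj (X \<omega>)
      = ft b \<omega> * cnj (ft (restr R x) \<omega>) + ft b \<omega> * cnj (X \<omega> - ft (restr R x) \<omega>)" for R \<omega>
    by (simp add: algebra_simps)
  have i1: "integrable lborel (\<lambda>\<omega>. ft b \<omega> * cnj (ft (restr R x) \<omega>))" for R
    using pR(1) by auto
  have i2: "integrable lborel (\<lambda>\<omega>. ft b \<omega> * cnj (X \<omega> - ft (restr R x) \<omega>))" if "D R \<in> L2" for R
  proof (rule integrable_mult_L2_complex[OF BL])
    show "(\<lambda>\<omega>. cmod (cnj (X \<omega> - ft (restr R x) \<omega>))) \<in> L2"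
      using that unfolding D_def complex_mod_cnj .
  qed measurable
  \<comment> \<open>One such radius already splits the integrand into two integrable
    products.\<close>
  obtain R0 where "D R0 \<in> L2"
    using ev[of 1] eventually_happens'[of at_top] by force
  then show int: "integrable lborel (\<lambda>\<omega>. ft b \<omega> * cnj (X \<omega>))"
    unfolding split[of _ R0] by (intro Bochner_Integration.integrable_add i1 i2)
  let ?I = "CLBINT \<omega>. cis (\<omega> * \<tau>) * (ft b \<omega> * cnj (X \<omega>))"
  have "cmod (?I - complex_of_real (2 * pi * corr x b \<tau>)) \<le> e" if e: "e > 0" for e
  proof -
    \<comment> \<open>Adding 1 keeps the divisor positive even when the transform of
      \<open>b\<close> vanishes.\<close>
    define N where "N = L2_norm (\<lambda>\<omega>. cmod (ft b \<omega>)) + 1"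
    have N: "N > 0" using L2_norm_nonneg[of "\<lambda>\<omega>. cmod (ft b \<omega>)"] by (simp add: N_def)
    have "\<forall>\<^sub>F R in at_top. R \<ge> \<bar>S\<bar> + \<bar>\<tau>\<bar> \<and> D R \<in> L2 \<and> L2_norm (D R) < e / N"
      using e N by (intro eventually_conj eventually_ge_at_top ev) auto
    then obtain R where R: "R \<ge> \<bar>S\<bar> + \<bar>\<tau>\<bar>" "D R \<in> L2" "L2_norm (D R) < e / N"
      using eventually_happens'[of at_top] by force
    \<comment> \<open>On the support of \<open>b\<close> the argument \<open>t - \<tau>\<close>
      stays within \<open>[-R, R]\<close> by the choice of \<open>R\<close>.\<close>
    have "corr (restr R x) b \<tau> = corr x b \<tau>"
      unfolding corr_def ip_def
    proof (intro Bochner_Integration.integral_cong refl)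
      fix t
      show "restr R x (t - \<tau>) * b t = x (t - \<tau>) * b t"
      proof (cases "\<bar>t\<bar> > S")
        case True then show ?thesis using b(3) by simp
      next
        case False
        then have "\<bar>t - \<tau>\<bar> \<le> R" using R(1) by linarith
        then show ?thesis by simp
      qed
    qed
    then have c: "(CLBINT \<omega>. cis (\<omega> * \<tau>) * (ft b \<omega> * cnj (ft (restr R x) \<omega>)))
        = complex_of_real (2 * pi * corr x b \<tau>)"
      using pR(2)[of \<tau> R] by simp
    have ic: "integrable lborel (\<lambda>\<omega>. cis (\<omega> * \<tau>) * F \<omega>)" if "integrable lborel F" for F :: "real \<Rightarrow> complex"
      using integrable_mult_bounded[OF that, of "\<lambda>\<omega>. cis (\<omega> * \<tau>)" 1] by (simp add: mult.commute)
    have "?I = (CLBINT \<omega>. cis (\<omega> * \<tau>) * (ft b \<omega> * cnj (ft (restr R x) \<omega>))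
        + cis (\<omega> * \<tau>) * (ft b \<omega> * cnj (X \<omega> - ft (restr R x) \<omega>)))"
      unfolding split[of _ R] by (simp only: distrib_left)
    also have "\<dots> = complex_of_real (2 * pi * corr x b \<tau>)
        + (CLBINT \<omega>. cis (\<omega> * \<tau>) * (ft b \<omega> * cnj (X \<omega> - ft (restr R x) \<omega>)))"
      unfolding c[symmetric] by (rule Bochner_Integration.integral_add[OF ic[OF i1] ic[OF i2[OF R(2)]]])
    finally have "cmod (?I - complex_of_real (2 * pi * corr x b \<tau>))
        = cmod (CLBINT \<omega>. cis (\<omega> * \<tau>) * (ft b \<omega> * cnj (X \<omega> - ft (restr R x) \<omega>)))"
      by simp
    also have "\<dots> \<le> (LBINT \<omega>. norm (cis (\<omega> * \<tau>) * (ft b \<omega> * cnj (X \<omega> - ft (restr R x) \<omega>))))"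
      by (rule integral_norm_bound)
    also have "\<dots> = ip (\<lambda>\<omega>. cmod (ft b \<omega>)) (D R)"
      unfolding ip_def D_def by (simp add: norm_mult flip: complex_cnj_diff)
    also have "\<dots> \<le> L2_norm (\<lambda>\<omega>. cmod (ft b \<omega>)) * L2_norm (D R)"
      using Cauchy_Schwarz_L2[OF BL R(2)] by simp
    also have "\<dots> \<le> N * (e / N)"
      using R(3) N L2_norm_nonneg[of "D R"] by (intro mult_mono) (auto simp: N_def)
    also have "\<dots> = e" using N by simp
    finally show ?thesis .
  qed
  then have "cmod (?I - complex_of_real (2 * pi * corr x b \<tau>)) \<le> 0"
    by (rule field_le_epsilon[where y = 0, simplified])
  then show "?I = complex_of_real (2 * pi * corr x b \<tau>)" by simp
qed

section \<open>Impulse responses and the multiplier in the frequency domain\<close>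

lemma conv_freq_eq_hint: "conv_freq h \<omega> = hint h (\<lambda>\<tau>. cis (- (\<omega> * \<tau>)))"
  by (simp add: conv_freq_def hint_def scaleR_conv_of_real)

lemma hint_of_real: "complex_of_real (hint h g) = hint h (\<lambda>\<tau>. complex_of_real (g \<tau>))"
proof -
  have "c *\<^sub>R complex_of_real z = complex_of_real (c * z)" for c z
    by (simp add: scaleR_conv_of_real)
  then show ?thesis
    unfolding hint_eq_integrals by (simp only: integral_complex_of_real of_real_add real_scaleR_def)
qed

lemma hint_mult_left:
  fixes g :: "real \<Rightarrow> complex"
  shows "hint h (\<lambda>\<tau>. g \<tau> * z) = hint h g * z"
proof -
  have "c *\<^sub>R (g \<tau> * z) = (c *\<^sub>R g \<tau>) * z" for c \<tau> by simp
  then show ?thesis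
    unfolding hint_eq_integrals by (simp only: integral_mult_left_zero distrib_right)
qed

lemma hint_cnj: "hint h (\<lambda>\<tau>. cnj (g \<tau>)) = cnj (hint h g)"
proof -
  have "c *\<^sub>R cnj z = cnj (c *\<^sub>R z)" for c z by simp
  then show ?thesis
    unfolding hint_eq_integrals by (simp only: Bochner_Integration.integral_cnj complex_cnj_add)
qed

text \<open>Parseval's identity at lag \<open>\<tau>\<close>, integrated against \<open>h\<close>.
  Fubini collects the factors \<open>cis (\<omega> * \<tau>)\<close> into the conjugate of the
  frequency response, as \<open>h\<close> is real.\<close>

lemma hint_corr_fourier:
  assumes h: "h \<in> H_space" and x: "x \<in> L2" "is_fourier x X"
    and b: "b \<in> borel_measurable borel" "\<And>t. \<bar>b t\<bar> \<le> C" "\<And>t. \<bar>t\<bar> > S \<Longrightarrow> b t = 0"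
  shows "integrable lborel (\<lambda>\<omega>. cnj (conv_freq h \<omega>) * (ft b \<omega> * cnj (X \<omega>)))"
    and "(CLBINT \<omega>. cnj (conv_freq h \<omega>) * (ft b \<omega> * cnj (X \<omega>)))
      = complex_of_real (2 * pi * hint h (corr x b))"
proof -
  let ?Z = "\<lambda>\<omega>. ft b \<omega> * cnj (X \<omega>)"
  have Z: "integrable lborel ?Z" "\<And>\<tau>. (CLBINT \<omega>. cis (\<omega> * \<tau>) * ?Z \<omega>) = complex_of_real (2 * pi * corr x b \<tau>)"
    using parseval_is_fourier[where C = C and S = S, OF x b] by auto
  have Zm [measurable]: "?Z \<in> borel_measurable borel" using Z(1) by simp
  have m: "(\<lambda>(\<tau>, \<omega>). cis (\<omega> * \<tau>) * ?Z \<omega>) \<in> borel_measurable (borel \<Otimes>\<^sub>M borel)"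
  proof -
    have "(\<lambda>p. ?Z (snd p)) \<in> borel_measurable (borel \<Otimes>\<^sub>M borel)"
      by (rule measurable_compose[OF measurable_snd Zm])
    then have "(\<lambda>p. cis (snd p * fst p) * ?Z (snd p)) \<in> borel_measurable (borel \<Otimes>\<^sub>M borel)"
      by measurable
    then show ?thesis by (simp add: case_prod_beta')
  qed
  have i: "integrable lborel (\<lambda>\<omega>. cis (\<omega> * \<tau>) * ?Z \<omega>)" for \<tau>
    using integrable_mult_bounded[OF Z(1), of "\<lambda>\<omega>. cis (\<omega> * \<tau>)" 1] by (simp add: mult.commute)
  have n: "(LBINT \<omega>. norm (cis (\<omega> * \<tau>) * ?Z \<omega>)) \<le> (LBINT \<omega>. norm (?Z \<omega>))" for \<tau>
    by (simp add: norm_mult)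
  have e: "hint h (\<lambda>\<tau>. cis (\<omega> * \<tau>) * ?Z \<omega>) = cnj (conv_freq h \<omega>) * ?Z \<omega>" for \<omega>
    unfolding hint_mult_left conv_freq_eq_hint hint_cnj[symmetric] by (simp add: cis_cnj)
  note F = hint_Fubini[OF h m i n, unfolded e Z(2)]
  show "integrable lborel (\<lambda>\<omega>. cnj (conv_freq h \<omega>) * ?Z \<omega>)" by (rule F(1))
  show "(CLBINT \<omega>. cnj (conv_freq h \<omega>) * ?Z \<omega>) = complex_of_real (2 * pi * hint h (corr x b))"
    unfolding F(2) hint_of_real[symmetric] hint_scale ..
qed

text \<open>The inner product of \<open>multiplier hp hm x\<close> with \<open>y\<close>, written through correlations.\<close>

definition Mform :: "gen_fun \<Rightarrow> gen_fun \<Rightarrow> signal \<Rightarrow> signal \<Rightarrow> real" where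
  "Mform hp hm x y = ip x y - hint hp (corr x y) + hint hm (corr x y)"

lemma Mform_fourier:
  assumes h: "hp \<in> H_space" "hm \<in> H_space" and x: "x \<in> L2" "is_fourier x X"
    and b: "b \<in> borel_measurable borel" "\<And>t. \<bar>b t\<bar> \<le> C" "\<And>t. \<bar>t\<bar> > S \<Longrightarrow> b t = 0"
  shows "integrable lborel (\<lambda>\<omega>. cnj (multiplier_freq hp hm \<omega>) * (ft b \<omega> * cnj (X \<omega>)))"
    and "(CLBINT \<omega>. cnj (multiplier_freq hp hm \<omega>) * (ft b \<omega> * cnj (X \<omega>)))
      = complex_of_real (2 * pi * Mform hp hm x b)"
proof -
  let ?Z = "\<lambda>\<omega>. ft b \<omega> * cnj (X \<omega>)"
  have e: "cnj (multiplier_freq hp hm \<omega>) * ?Z \<omega>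
      = ?Z \<omega> - cnj (conv_freq hp \<omega>) * ?Z \<omega> + cnj (conv_freq hm \<omega>) * ?Z \<omega>" for \<omega>
    by (simp add: multiplier_freq_def algebra_simps)
  have p: "integrable lborel (\<lambda>\<omega>. cnj (conv_freq hp \<omega>) * ?Z \<omega>)"
    "(CLBINT \<omega>. cnj (conv_freq hp \<omega>) * ?Z \<omega>) = complex_of_real (2 * pi * hint hp (corr x b))"
    using hint_corr_fourier[where C = C and S = S, OF h(1) x b] by auto
  have m: "integrable lborel (\<lambda>\<omega>. cnj (conv_freq hm \<omega>) * ?Z \<omega>)"
    "(CLBINT \<omega>. cnj (conv_freq hm \<omega>) * ?Z \<omega>) = complex_of_real (2 * pi * hint hm (corr x b))"
    using hint_corr_fourier[where C = C and S = S, OF h(2) x b] by auto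
  have z: "integrable lborel ?Z" "(CLBINT \<omega>. ?Z \<omega>) = complex_of_real (2 * pi * ip x b)"
    using parseval_is_fourier(1)[where C = C and S = S, OF x b]
      parseval_is_fourier(2)[where C = C and S = S and \<tau> = 0, OF x b] by (auto simp: corr_0)
  show "integrable lborel (\<lambda>\<omega>. cnj (multiplier_freq hp hm \<omega>) * ?Z \<omega>)"
    unfolding e using z(1) p(1) m(1) by (intro Bochner_Integration.integrable_add Bochner_Integration.integrable_diff)
  have "(CLBINT \<omega>. cnj (multiplier_freq hp hm \<omega>) * ?Z \<omega>)
      = (CLBINT \<omega>. ?Z \<omega>) - (CLBINT \<omega>. cnj (conv_freq hp \<omega>) * ?Z \<omega>) + (CLBINT \<omega>. cnj (conv_freq hm \<omega>) * ?Z \<omega>)"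
    unfolding e using z(1) p(1) m(1)
    by (simp only: Bochner_Integration.integral_add Bochner_Integration.integral_diff
      Bochner_Integration.integrable_diff)
  then show "(CLBINT \<omega>. cnj (multiplier_freq hp hm \<omega>) * ?Z \<omega>) = complex_of_real (2 * pi * Mform hp hm x b)"
    unfolding z(2) p(2) m(2) Mform_def by (simp add: algebra_simps)
qed

text \<open>By Parseval both forms become integrals against the energy density of
  \<open>ft b\<close>, and the assumed lower bound is integrated pointwise.\<close>

lemma frequency_inequality_bounded_support:
  assumes h: "hp \<in> H_space" "hm \<in> H_space"
    and fr: "frequency_response G Gj" and Gb: "G b \<in> L2"
    and eps: "\<And>\<omega>. Re (multiplier_freq hp hm \<omega> * (1 + complex_of_real k * Gj \<omega>)) \<ge> \<epsilon>"
    and b: "b \<in> borel_measurable borel" "\<And>t. \<bar>b t\<bar> \<le> C" "\<And>t. \<bar>t\<bar> > S \<Longrightarrow> b t = 0"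
  shows "\<epsilon> * ip b b \<le> Mform hp hm b b + k * Mform hp hm (G b) b"
proof -
  let ?M = "multiplier_freq hp hm" and ?B = "ft b"
  have bL: "b \<in> L2" using L2_bounded_support[where C = C and S = S, OF b] by auto
  have fb: "is_fourier b ?B" using is_fourier_bounded_support[where C = C and S = S, OF b] by auto
  then have fG: "is_fourier (G b) (\<lambda>\<omega>. Gj \<omega> * ?B \<omega>)"
    using fr bL by (auto simp: frequency_response_def)
  let ?Z1 = "\<lambda>\<omega>. cnj (?M \<omega>) * (?B \<omega> * cnj (?B \<omega>))"
  let ?Z2 = "\<lambda>\<omega>. cnj (?M \<omega>) * (?B \<omega> * cnj (Gj \<omega> * ?B \<omega>))"
  have 1: "integrable lborel ?Z1" "(CLBINT \<omega>. ?Z1 \<omega>) = complex_of_real (2 * pi * Mform hp hm b b)"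
    using Mform_fourier[where C = C and S = S, OF h bL fb b] by auto
  have 2: "integrable lborel ?Z2" "(CLBINT \<omega>. ?Z2 \<omega>) = complex_of_real (2 * pi * Mform hp hm (G b) b)"
    using Mform_fourier[where C = C and S = S, OF h Gb fG b] by auto
  have 0: "integrable lborel (\<lambda>\<omega>. ?B \<omega> * cnj (?B \<omega>))"
      "(CLBINT \<omega>. ?B \<omega> * cnj (?B \<omega>)) = complex_of_real (2 * pi * ip b b)"
    using parseval_is_fourier(1)[where C = C and S = S, OF bL fb b]
      parseval_is_fourier(2)[where C = C and S = S and \<tau> = 0, OF bL fb b] by (auto simp: corr_0)
  have "\<epsilon> * (2 * pi * ip b b) = (LBINT \<omega>. \<epsilon> * Re (?B \<omega> * cnj (?B \<omega>)))"
    using arg_cong[OF 0(2), of Re] 0(1) by (simp flip: integral_Re)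
  also have "\<dots> \<le> (LBINT \<omega>. Re (?Z1 \<omega> + complex_of_real k * ?Z2 \<omega>))"
  proof (rule integral_mono)
    show "integrable lborel (\<lambda>\<omega>. \<epsilon> * Re (?B \<omega> * cnj (?B \<omega>)))"
      by (intro integrable_mult_right integrable_Re 0)
    show "integrable lborel (\<lambda>\<omega>. Re (?Z1 \<omega> + complex_of_real k * ?Z2 \<omega>))"
      by (intro integrable_Re Bochner_Integration.integrable_add integrable_mult_right 1 2)
    fix \<omega>
    \<comment> \<open>Parseval delivers the conjugate of the frequency-domain quantity, which has
      the same real part.\<close>
    have "?Z1 \<omega> + complex_of_real k * ?Z2 \<omega>
        = cnj (?M \<omega> * (1 + complex_of_real k * Gj \<omega>)) * complex_of_real ((cmod (?B \<omega>))\<^sup>2)"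
      unfolding complex_norm_square by (simp add: algebra_simps)
    then have "Re (?Z1 \<omega> + complex_of_real k * ?Z2 \<omega>)
        = Re (?M \<omega> * (1 + complex_of_real k * Gj \<omega>)) * (cmod (?B \<omega>))\<^sup>2"
      by (simp del: of_real_power complex_cnj_mult)
    moreover have "\<epsilon> * Re (?B \<omega> * cnj (?B \<omega>)) = \<epsilon> * (cmod (?B \<omega>))\<^sup>2"
      unfolding complex_norm_square[symmetric] by simp
    ultimately show "\<epsilon> * Re (?B \<omega> * cnj (?B \<omega>)) \<le> Re (?Z1 \<omega> + complex_of_real k * ?Z2 \<omega>)"
      by (simp only: mult_right_mono[OF eps zero_le_power2])
  qed
  also have "\<dots> = Re (CLBINT \<omega>. ?Z1 \<omega> + complex_of_real k * ?Z2 \<omega>)"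
    by (intro integral_Re Bochner_Integration.integrable_add integrable_mult_right 1 2)
  also have "(CLBINT \<omega>. ?Z1 \<omega> + complex_of_real k * ?Z2 \<omega>)
      = (CLBINT \<omega>. ?Z1 \<omega>) + complex_of_real k * (CLBINT \<omega>. ?Z2 \<omega>)"
    using 1(1) 2(1) by (simp only: Bochner_Integration.integral_add integrable_mult_right integral_mult_right_zero)
  also have "Re \<dots> = 2 * pi * (Mform hp hm b b + k * Mform hp hm (G b) b)"
    unfolding 1(2) 2(2) by (simp add: algebra_simps)
  finally have "2 * pi * (\<epsilon> * ip b b) \<le> 2 * pi * (Mform hp hm b b + k * Mform hp hm (G b) b)"
    by (simp add: algebra_simps)
  then show ?thesis by (simp add: mult_le_cancel_left)
qed

section \<open>Continuity of the multiplier form in mean square\<close>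

lemma corr_add_left: "x \<in> L2 \<Longrightarrow> y \<in> L2 \<Longrightarrow> z \<in> L2 \<Longrightarrow> corr (\<lambda>t. x t + y t) z \<tau> = corr x z \<tau> + corr y z \<tau>"
  unfolding corr_def by (intro ip_add_left L2_translate)

lemma corr_scale_left: "corr (\<lambda>t. c * x t) z \<tau> = c * corr x z \<tau>"
  unfolding corr_def by (rule ip_scale_left)

lemma hint_corr_add_left:
  assumes "h \<in> H_space" "x \<in> L2" "y \<in> L2" "z \<in> L2"
  shows "hint h (corr (\<lambda>t. x t + y t) z) = hint h (corr x z) + hint h (corr y z)"
proof -
  have "hint h (\<lambda>\<tau>. corr x z \<tau> + corr y z \<tau>) = hint h (corr x z) + hint h (corr y z)"
    by (rule hint_add[OF assms(1)])
      (use assms corr_le L2_measurable in \<open>auto intro!: corr_measurable\<close>)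
  then show ?thesis using corr_add_left[OF assms(2-4)] by presburger
qed

lemma Mform_add_left:
  assumes "hp \<in> H_space" "hm \<in> H_space" "x \<in> L2" "y \<in> L2" "z \<in> L2"
  shows "Mform hp hm (\<lambda>t. x t + y t) z = Mform hp hm x z + Mform hp hm y z"
  using assms by (simp add: Mform_def hint_corr_add_left ip_add_left)

lemma Mform_scale_left: "Mform hp hm (\<lambda>t. c * x t) z = c * Mform hp hm x z"
  by (simp add: Mform_def ip_scale_left hint_scale corr_scale_left[abs_def] algebra_simps)

lemma Mform_diff_left:
  assumes "hp \<in> H_space" "hm \<in> H_space" "x \<in> L2" "y \<in> L2" "z \<in> L2"
  shows "Mform hp hm (\<lambda>t. x t - y t) z = Mform hp hm x z - Mform hp hm y z"
  using Mform_add_left[OF assms(1-3) L2_scale[OF assms(4), of "-1"] assms(5)] Mform_scale_left[of hp hm "-1" y z]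
  by simp

lemma Mform_diff_right:
  assumes "hp \<in> H_space" "hm \<in> H_space" "x \<in> L2" "y \<in> L2" "z \<in> L2"
  shows "Mform hp hm z (\<lambda>t. x t - y t) = Mform hp hm z x - Mform hp hm z y"
proof -
  have c: "corr z (\<lambda>t. x t - y t) = (\<lambda>\<tau>. corr z x \<tau> + (-1) * corr z y \<tau>)"
    unfolding corr_def ip_commute[of "\<lambda>t. z (t - _)"] using assms ip_diff_left[OF _ _ L2_translate[OF assms(5)]] by auto
  have "hint h (\<lambda>\<tau>. corr z x \<tau> + (-1) * corr z y \<tau>) = hint h (corr z x) + hint h (\<lambda>\<tau>. (-1) * corr z y \<tau>)"
    if "h \<in> H_space" for h
    by (rule hint_add[OF that]) (use assms corr_le L2_measurable in \<open>auto intro!: corr_measurable\<close>)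
  then show ?thesis
    using assms unfolding Mform_def c hint_scale ip_commute[of z] by (simp add: ip_diff_left)
qed

lemma Mform_bound:
  assumes "hp \<in> H_space" "hm \<in> H_space" "x \<in> L2" "y \<in> L2"
  shows "\<bar>Mform hp hm x y\<bar> \<le> (1 + H_norm hp + H_norm hm) * (L2_norm x * L2_norm y)"
proof -
  have m: "corr x y \<in> borel_measurable borel"
    using assms by (intro corr_measurable L2_measurable)
  have "\<bar>hint h (corr x y)\<bar> \<le> (L2_norm x * L2_norm y) * H_norm h" if "h \<in> H_space" for h
    using norm_hint_le[OF that m, of "L2_norm x * L2_norm y"] corr_le[OF assms(3,4)] by simp
  from this[OF assms(1)] this[OF assms(2)] Cauchy_Schwarz_L2[OF assms(3,4)]
  show ?thesis unfolding Mform_def by (simp add: algebra_simps)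
qed

text \<open>The error splits into the forms at \<open>(dx, dy)\<close>, \<open>(dx, y)\<close> and
  \<open>(x, dy)\<close>, each of which vanishes in the limit. The form is abstract so that both
  \<open>Mform\<close> and \<open>ip\<close> can be inserted.\<close>

lemma bounded_bilinear_tendsto_L2:
  fixes \<Phi> :: "signal \<Rightarrow> signal \<Rightarrow> real"
  assumes l: "\<And>x y z. x \<in> L2 \<Longrightarrow> y \<in> L2 \<Longrightarrow> z \<in> L2 \<Longrightarrow> \<Phi> (\<lambda>t. x t - y t) z = \<Phi> x z - \<Phi> y z"
    and r: "\<And>x y z. x \<in> L2 \<Longrightarrow> y \<in> L2 \<Longrightarrow> z \<in> L2 \<Longrightarrow> \<Phi> z (\<lambda>t. x t - y t) = \<Phi> z x - \<Phi> z y"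
    and bd: "\<And>x y. x \<in> L2 \<Longrightarrow> y \<in> L2 \<Longrightarrow> \<bar>\<Phi> x y\<bar> \<le> K * (L2_norm x * L2_norm y)"
    and x: "x \<in> L2" "\<And>n::nat. xs n \<in> L2" "(\<lambda>n. L2_norm (\<lambda>t. xs n t - x t)) \<longlonglongrightarrow> 0"
    and y: "y \<in> L2" "\<And>n. ys n \<in> L2" "(\<lambda>n. L2_norm (\<lambda>t. ys n t - y t)) \<longlonglongrightarrow> 0"
  shows "(\<lambda>n. \<Phi> (xs n) (ys n)) \<longlonglongrightarrow> \<Phi> x y"
proof (rule LIM_zero_cancel, rule Lim_null_comparison)
  let ?dx = "\<lambda>n t. xs n t - x t" and ?dy = "\<lambda>n t. ys n t - y t"
  have dx: "?dx n \<in> L2" for n using L2_diff[OF x(2,1)] .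
  have dy: "?dy n \<in> L2" for n using L2_diff[OF y(2,1)] .
  have "norm (\<Phi> (xs n) (ys n) - \<Phi> x y)
      \<le> K * (L2_norm (?dx n) * L2_norm (?dy n)) + K * (L2_norm (?dx n) * L2_norm y) + K * (L2_norm x * L2_norm (?dy n))"
    for n
  proof -
    have "\<Phi> (xs n) (ys n) - \<Phi> x y = \<Phi> (?dx n) (?dy n) + \<Phi> (?dx n) y + \<Phi> x (?dy n)"
      using x y dx dy by (simp add: l r)
    then show ?thesis
      using bd[OF dx dy, of n n] bd[OF dx y(1), of n] bd[OF x(1) dy, of n] by simp
  qed
  then show "\<forall>\<^sub>F n in sequentially. norm (\<Phi> (xs n) (ys n) - \<Phi> x y)
      \<le> K * (L2_norm (?dx n) * L2_norm (?dy n)) + K * (L2_norm (?dx n) * L2_norm y) + K * (L2_norm x * L2_norm (?dy n))"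
    by simp
  have "(\<lambda>n. K * (L2_norm (?dx n) * L2_norm (?dy n)) + K * (L2_norm (?dx n) * L2_norm y) + K * (L2_norm x * L2_norm (?dy n)))
      \<longlonglongrightarrow> K * (0 * 0) + K * (0 * L2_norm y) + K * (L2_norm x * 0)"
    by (intro tendsto_intros x y)
  then show "(\<lambda>n. K * (L2_norm (?dx n) * L2_norm (?dy n)) + K * (L2_norm (?dx n) * L2_norm y) + K * (L2_norm x * L2_norm (?dy n)))
      \<longlonglongrightarrow> 0" by simp
qed

lemma L2_subset_L2e: "x \<in> L2 \<Longrightarrow> x \<in> L2e"
proof -
  assume x: "x \<in> L2"
  note [measurable] = L2_measurable[OF x]
  have "trunc T x \<in> L2" for T
    unfolding trunc_def by (rule L2_bound[OF _ x]) auto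
  then show ?thesis using x by (simp add: L2e_def L2_def)
qed

lemma restr_tendsto_L2:
  assumes b: "b \<in> L2"
  shows "(\<lambda>n. L2_norm (\<lambda>t. restr (real n) b t - b t)) \<longlonglongrightarrow> 0"
proof (rule L2_norm_tendsto_0[where w = "\<lambda>t. (b t)\<^sup>2"])
  show "(\<lambda>t. restr (real n) b t - b t) \<in> borel_measurable borel" for n
    using L2_measurable[OF L2_diff[OF restr_L2[OF b] b]] .
  show "integrable lborel (\<lambda>t. (b t)\<^sup>2)" by (rule L2_square_integrable[OF b])
  show "AE t in lborel. (\<lambda>n. restr (real n) b t - b t) \<longlonglongrightarrow> 0"
  proof (rule AE_I2, rule tendsto_eventually)
    fix t
    obtain N where "\<bar>t\<bar> \<le> real N" using real_arch_simple by blast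
    then show "\<forall>\<^sub>F n in sequentially. restr (real n) b t - b t = 0"
      unfolding eventually_sequentially by (intro exI[of _ N]) auto
  qed
qed simp

text \<open>Density: the restrictions of \<open>b\<close> to \<open>[-n, n]\<close> converge to
  \<open>b\<close> in mean square, linearity and finite gain carry this over to \<open>G\<close>,
  and both sides are continuous.\<close>

lemma frequency_inequality:
  assumes h: "hp \<in> H_space" "hm \<in> H_space"
    and G: "linear_op G" "stable_op G" and fr: "frequency_response G Gj"
    and eps: "\<And>\<omega>. Re (multiplier_freq hp hm \<omega> * (1 + complex_of_real k * Gj \<omega>)) \<ge> \<epsilon>"
    and b: "b \<in> L2" "\<And>t. \<bar>b t\<bar> \<le> C"
  shows "\<epsilon> * ip b b \<le> Mform hp hm b b + k * Mform hp hm (G b) b"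
proof -
  let ?b = "\<lambda>n. restr (real n) b"
  have bn: "?b n \<in> L2" for n by (rule restr_L2[OF b(1)])
  note lim_b = restr_tendsto_L2[OF b(1)]
  obtain \<gamma> where GL: "\<And>u. u \<in> L2 \<Longrightarrow> G u \<in> L2" and \<gamma>: "\<And>u. u \<in> L2 \<Longrightarrow> L2_norm (G u) \<le> \<gamma> * L2_norm u"
    using G(2) by (auto simp: stable_op_def)
  have lim_G: "(\<lambda>n. L2_norm (\<lambda>t. G (?b n) t - G b t)) \<longlonglongrightarrow> 0"
  proof (rule Lim_null_comparison)
    have "L2_norm (\<lambda>t. G (?b n) t - G b t) \<le> \<gamma> * L2_norm (\<lambda>t. ?b n t - b t)" for n
    proof -
      have d: "(\<lambda>t. ?b n t - b t) \<in> L2" by (rule L2_diff[OF bn b(1)])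
      have "G (\<lambda>t. 1 * ?b n t + (-1) * b t) \<doteq> (\<lambda>t. 1 * G (?b n) t + (-1) * G b t)"
        by (rule G(1)[unfolded linear_op_def, rule_format, OF L2_subset_L2e[OF bn] L2_subset_L2e[OF b(1)]])
      then have "G (\<lambda>t. ?b n t - b t) \<doteq> (\<lambda>t. G (?b n) t - G b t)" by simp
      then have "L2_norm (G (\<lambda>t. ?b n t - b t)) = L2_norm (\<lambda>t. G (?b n) t - G b t)"
        by (rule L2_norm_ae_eq) (intro L2_measurable GL d L2_diff bn b)+
      then show ?thesis using \<gamma>[OF d] by simp
    qed
    then show "\<forall>\<^sub>F n in sequentially. norm (L2_norm (\<lambda>t. G (?b n) t - G b t)) \<le> \<gamma> * L2_norm (\<lambda>t. ?b n t - b t)"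
      by (simp add: L2_norm_nonneg)
    show "(\<lambda>n. \<gamma> * L2_norm (\<lambda>t. ?b n t - b t)) \<longlonglongrightarrow> 0"
      by (rule tendsto_mult_right_zero[OF lim_b])
  qed
  note Mlim = bounded_bilinear_tendsto_L2[of "Mform hp hm", OF Mform_diff_left[OF h] Mform_diff_right[OF h] Mform_bound[OF h]]
  have 1: "(\<lambda>n. Mform hp hm (?b n) (?b n)) \<longlonglongrightarrow> Mform hp hm b b"
    by (rule Mlim) (use b bn lim_b in auto)
  have 2: "(\<lambda>n. Mform hp hm (G (?b n)) (?b n)) \<longlonglongrightarrow> Mform hp hm (G b) b"
    by (rule Mlim) (use b bn lim_b lim_G GL in auto)
  have 3: "(\<lambda>n. ip (?b n) (?b n)) \<longlonglongrightarrow> ip b b"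
  proof (rule bounded_bilinear_tendsto_L2[of ip, where K = 1])
    show "ip z (\<lambda>t. x t - y t) = ip z x - ip z y" if "x \<in> L2" "y \<in> L2" "z \<in> L2" for x y z
      using ip_diff_left[OF that] by (simp add: ip_commute)
  qed (use b bn lim_b Cauchy_Schwarz_L2 ip_diff_left in auto)
  have C: "0 \<le> C" using b(2) abs_ge_zero order_trans by blast
  have "\<epsilon> * ip (?b n) (?b n) \<le> Mform hp hm (?b n) (?b n) + k * Mform hp hm (G (?b n)) (?b n)" for n
    by (rule frequency_inequality_bounded_support[OF h fr GL[OF bn] eps L2_measurable[OF bn], where C = C and S = "real n"])
      (use b(2) C in auto)
  then show ?thesis
    by (intro LIMSEQ_le[OF tendsto_mult_left[OF 3] tendsto_add[OF 1 tendsto_mult_left[OF 2]]]) auto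
qed

section \<open>The saturation and the loop\<close>

lemma sat_measurable:
  assumes "u \<in> borel_measurable borel"
  shows "sat_op s a b u \<in> borel_measurable borel"
  using assms unfolding sat_op_def sat_def by measurable

lemma sat_range:
  assumes "s > 0" "m > 0" "n > 0"
  shows "- m \<le> sat s (-m) n x" "sat s (-m) n x \<le> n"
  using assms by (auto simp: sat_def field_simps)

lemma sat_abs_le:
  assumes "s > 0" "m > 0" "n > 0"
  shows "\<bar>sat s (-m) n x\<bar> \<le> m + n" and "\<bar>sat s (-m) n x\<bar> \<le> \<bar>s * x\<bar>"
proof -
  show "\<bar>sat s (-m) n x\<bar> \<le> m + n"
    using sat_range[OF assms, of x] assms by linarith
  show "\<bar>sat s (-m) n x\<bar> \<le> \<bar>s * x\<bar>"
    using assms by (auto simp: sat_def field_simps abs_if)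
qed

lemma sat_0: "s > 0 \<Longrightarrow> m > 0 \<Longrightarrow> n > 0 \<Longrightarrow> sat s (-m) n 0 = 0"
  by (auto simp: sat_def field_simps)

lemma sat_op_L2:
  assumes "s > 0" "m > 0" "n > 0" "u \<in> L2"
  shows "sat_op s (-m) n u \<in> L2"
  by (rule L2_bound[OF sat_measurable L2_scale[OF assms(4), of s]])
    (use assms sat_abs_le(2) L2_measurable in \<open>auto simp: sat_op_def\<close>)

text \<open>Splitting \<open>u = v + w / k\<close> with \<open>w\<close> the saturated value, \<open>v\<close> is linear in \<open>w\<close> until \<open>w\<close> saturates.\<close>

lemma sat_residual_cases:
  fixes s m n k u :: real
  assumes "s > 0" "m > 0" "n > 0" "k \<ge> s"
  defines "w \<equiv> sat s (-m) n u" and "c \<equiv> (1 / s - 1 / k) / 2"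
  defines "v \<equiv> u - w / k"
  obtains "w = - m" "v \<le> - (2 * c * m)" | "v = 2 * c * w" "- m \<le> w" "w \<le> n" | "w = n" "2 * c * n \<le> v"
proof -
  \<comment> \<open>\<open>2 * c\<close> is the slope of \<open>v\<close> against \<open>w\<close>
    in the linear range, so \<open>- (2 * c * m)\<close> and \<open>2 * c * n\<close> are the values
    of \<open>v\<close> at the two corners.\<close>
  have c2: "2 * c * a = a / s - a / k" for a
    using assms(1,4) by (simp add: c_def field_simps)
  consider "u < - m / s" | "- m / s \<le> u" "u \<le> n / s" | "n / s < u" by linarith
  then show thesis
  proof cases
    case 1
    then have w: "w = - m" by (simp add: w_def sat_def)
    moreover have "v \<le> - (2 * c * m)" unfolding c2 using 1 w by (simp add: v_def)
    ultimately show thesis by (rule that(1))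
  next
    case 2
    then have w: "w = s * u" using assms(1) by (simp add: w_def sat_def)
    have "v = 2 * c * w" using assms(1,4) by (simp add: v_def c_def w field_simps)
    then show thesis using sat_range[OF assms(1-3)] by (intro that(2)) (auto simp: w_def)
  next
    case 3
    have "- m / s < n / s" using assms by (intro divide_strict_right_mono) auto
    then have w: "w = n" using 3 by (simp add: w_def sat_def)
    moreover have "2 * c * n \<le> v" unfolding c2 using 3 w by (simp add: v_def)
    ultimately show thesis by (rule that(3))
  qed
qed

text \<open>Let \<open>F\<close> be the convex function of \<open>v\<close> with value
  \<open>v * w - c * w\<^sup>2\<close>. The second claim is its subgradient inequality with slope
  \<open>w\<close> at \<open>v\<close>. The third is a Fenchel inequality with conjugate value
  \<open>c * w\<^sup>2\<close>, the factor \<open>B\<close> paying for the sign change of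
  \<open>v'\<close>.\<close>

lemma sat_residual_inequalities:
  fixes s m n k u u' :: real
  assumes "s > 0" "m > 0" "n > 0" "k \<ge> s"
  defines "c \<equiv> (1 / s - 1 / k) / 2" and "B \<equiv> max m n / min m n"
  defines "w \<equiv> sat s (-m) n u" and "w' \<equiv> sat s (-m) n u'"
  defines "v \<equiv> u - w / k" and "v' \<equiv> u' - w' / k"
  shows "0 \<le> v * w"
    and "v' * w \<le> v * w + ((v' * w' - c * w'\<^sup>2) - (v * w - c * w\<^sup>2))"
    and "- (v' * w) \<le> B * (v' * w' - c * w'\<^sup>2) + c * w\<^sup>2"
proof -
  have c: "0 \<le> c" using assms(1,4) by (simp add: c_def frac_le)
  have B: "1 \<le> B" "m \<le> B * n" "n \<le> B * m"
    using assms(2,3) by (auto simp: B_def field_simps max_def min_def mult_mono)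
  have wr: "- m \<le> w" "w \<le> n" using sat_range[OF assms(1-3)] by (auto simp: w_def)
  show "0 \<le> v * w"
    using sat_residual_cases[OF assms(1-4), of u, folded w_def c_def v_def]
  proof cases
    case 1
    have "0 \<le> 2 * c * m" using c assms(2) by simp
    then have "v \<le> 0" using 1 by linarith
    then show ?thesis using 1 assms(2) by (intro mult_nonpos_nonpos) auto
  next
    case 2 then show ?thesis using c by simp
  next
    case 3
    have "0 \<le> 2 * c * n" using c assms(3) by simp
    then have "0 \<le> v" using 3 by linarith
    then show ?thesis using 3 assms(3) by simp
  qed
  \<comment> \<open>The terms in \<open>v * w\<close> cancel from the subgradient inequality,
    leaving this product, whose factors never have opposite strict signs.\<close>
  have "0 \<le> (w' - w) * (v' - c * (w' + w))"
    using sat_residual_cases[OF assms(1-4), of u', folded w'_def c_def v'_def]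
  proof cases
    case 1
    have "0 \<le> c * (m + w)" using c wr by simp
    then have "v' - c * (w' + w) \<le> 0" using 1 by (simp add: algebra_simps)
    then show ?thesis using 1 wr by (intro mult_nonpos_nonpos) auto
  next
    case 2
    then have "(w' - w) * (v' - c * (w' + w)) = c * (w' - w)\<^sup>2" by (simp add: power2_eq_square algebra_simps)
    then show ?thesis using c by simp
  next
    case 3
    have "0 \<le> c * (n - w)" using c wr by simp
    then have "v' - c * (w' + w) \<ge> 0" using 3 by (simp add: algebra_simps)
    then show ?thesis using 3 wr by simp
  qed
  then show "v' * w \<le> v * w + ((v' * w' - c * w'\<^sup>2) - (v * w - c * w\<^sup>2))"
    by (simp add: power2_eq_square algebra_simps)
  \<comment> \<open>A completed square that uses \<open>B \<ge> 1\<close>; \<open>a\<close> will be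
    the value of \<open>w'\<close>, either saturated or in the linear range.\<close>
  have sq: "0 \<le> B * (c * a\<^sup>2) + 2 * c * a * w + c * w\<^sup>2" for a
  proof -
    have "0 \<le> (B - 1) * (c * a\<^sup>2) + c * (a + w)\<^sup>2" using B(1) c by simp
    then show ?thesis by (simp add: power2_eq_square algebra_simps)
  qed
  show "- (v' * w) \<le> B * (v' * w' - c * w'\<^sup>2) + c * w\<^sup>2"
    using sat_residual_cases[OF assms(1-4), of u', folded w'_def c_def v'_def]
  proof cases
    case 1
    \<comment> \<open>\<open>B * m - w\<close> is nonnegative because \<open>n \<le> B * m\<close>;
      here the ratio of the saturation levels enters.\<close>
    have "2 * c * m * (B * m - w) \<le> (- v') * (B * m - w)"
      using 1 B wr by (intro mult_right_mono) auto
    then show ?thesis using 1 sq[of "-m"] by (simp add: power2_eq_square algebra_simps)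
  next
    case 2
    then show ?thesis using sq[of w'] by (simp add: power2_eq_square algebra_simps)
  next
    case 3
    \<comment> \<open>The mirror case rests on \<open>m \<le> B * n\<close>.\<close>
    have "2 * c * n * (B * n + w) \<le> v' * (B * n + w)"
      using 3 B wr by (intro mult_right_mono) auto
    then show ?thesis using 3 sq[of n] by (simp add: power2_eq_square algebra_simps)
  qed
qed

section \<open>Positivity of the multiplier form\<close>

text \<open>The pointwise inequalities are applied with the signal at time \<open>t\<close> and its
  delayed value as \<open>u\<close> and \<open>u'\<close>. Integration confines the correlation at
  every lag to \<open>[- B * ip v w, ip v w]\<close>, and integrating over the nonnegative
  \<open>hp\<close> and \<open>hm\<close> leaves \<open>ip v w\<close> times the slack in the norm
  condition.\<close>

lemma Mform_sat_nonneg: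
  fixes s m n k :: real
  assumes par: "s > 0" "m > 0" "n > 0" "k \<ge> s"
    and hp: "hp \<in> Hp_space" and hm: "hm \<in> Hp_space"
    and H: "H_norm hp + (max m n / min m n) * H_norm hm < 1"
    and u: "u \<in> L2"
  shows "0 \<le> Mform hp hm (\<lambda>t. u t - sat_op s (-m) n u t / k) (sat_op s (-m) n u)"
proof -
  let ?w = "sat_op s (-m) n u" and ?c = "(1 / s - 1 / k) / 2" and ?B = "max m n / min m n"
  let ?v = "\<lambda>t. u t - ?w t / k"
  have w: "?w \<in> L2" by (rule sat_op_L2[OF par(1-3) u])
  have v: "?v \<in> L2" by (intro L2_diff u L2_divide w)
  have h: "hp \<in> H_space" "hm \<in> H_space" using hp hm by (auto simp: Hp_space_def)
  have c: "0 \<le> ?c" using par by (simp add: frac_le)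
  have B: "1 \<le> ?B" using par by (auto simp: field_simps max_def min_def)
  note ineq = sat_residual_inequalities[OF par]
  have vw: "integrable lborel (\<lambda>t. ?v t * ?w t)" by (rule L2_mult_integrable[OF v w])
  have ww: "integrable lborel (\<lambda>t. (?w t)\<^sup>2)" by (rule L2_square_integrable[OF w])
  let ?P = "\<lambda>t. ?v t * ?w t - ?c * (?w t)\<^sup>2"
  have P: "integrable lborel ?P" using vw ww by (intro Bochner_Integration.integrable_diff integrable_mult_right)
  have P\<tau>: "integrable lborel (\<lambda>t. ?P (t - \<tau>))" for \<tau> by (rule integrable_translate[OF P])
  \<comment> \<open>Translation invariance: in the upper bound the two integrals of
    \<open>?P\<close> therefore cancel.\<close>
  have IP: "(LBINT t. ?P (t - \<tau>)) = (LBINT t. ?P t)" for \<tau> by (rule integral_translate)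
  have I: "(LBINT t. ?P t) = ip ?v ?w - ?c * ip ?w ?w"
    using vw ww by (simp add: ip_def power2_eq_square)
  have vw\<tau>: "integrable lborel (\<lambda>t. ?v (t - \<tau>) * ?w t)" for \<tau>
    by (rule L2_mult_integrable[OF L2_translate[OF v] w])
  have pos: "0 \<le> ip ?v ?w"
    unfolding ip_def using ineq(1) by (intro Bochner_Integration.integral_nonneg) (simp add: sat_op_def)
  have wpos: "0 \<le> ip ?w ?w" by (simp add: ip_def Bochner_Integration.integral_nonneg)
  have up: "corr ?v ?w \<tau> \<le> ip ?v ?w" for \<tau>
  proof -
    have "corr ?v ?w \<tau> \<le> (LBINT t. ?v t * ?w t + (?P (t - \<tau>) - ?P t))"
      unfolding corr_def ip_def
    proof (rule integral_mono[OF vw\<tau>])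
      show "integrable lborel (\<lambda>t. ?v t * ?w t + (?P (t - \<tau>) - ?P t))"
        by (intro Bochner_Integration.integrable_add Bochner_Integration.integrable_diff vw P\<tau> P)
      show "?v (t - \<tau>) * ?w t \<le> ?v t * ?w t + (?P (t - \<tau>) - ?P t)" for t
        unfolding sat_op_def by (rule ineq(2))
    qed
    also have "\<dots> = (LBINT t. ?v t * ?w t) + ((LBINT t. ?P (t - \<tau>)) - (LBINT t. ?P t))"
      by (simp only: Bochner_Integration.integral_add Bochner_Integration.integral_diff
          Bochner_Integration.integrable_diff vw P\<tau> P)
    also have "\<dots> = ip ?v ?w" unfolding IP ip_def by simp
    finally show ?thesis .
  qed
  have lo: "- (?B * ip ?v ?w) \<le> corr ?v ?w \<tau>" for \<tau>
  proof -
    have "(LBINT t. - (?v (t - \<tau>) * ?w t)) \<le> (LBINT t. ?B * ?P (t - \<tau>) + ?c * (?w t)\<^sup>2)"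
    proof (rule integral_mono)
      show "integrable lborel (\<lambda>t. - (?v (t - \<tau>) * ?w t))" using vw\<tau> by simp
      show "integrable lborel (\<lambda>t. ?B * ?P (t - \<tau>) + ?c * (?w t)\<^sup>2)"
        by (intro Bochner_Integration.integrable_add integrable_mult_right P\<tau> ww)
      show "- (?v (t - \<tau>) * ?w t) \<le> ?B * ?P (t - \<tau>) + ?c * (?w t)\<^sup>2" for t
        unfolding sat_op_def by (rule ineq(3))
    qed
    also have "\<dots> = ?B * (LBINT t. ?P (t - \<tau>)) + ?c * (LBINT t. (?w t)\<^sup>2)"
      by (simp only: Bochner_Integration.integral_add integrable_mult_right P\<tau> ww integral_mult_right_zero)
    also have "\<dots> = ?B * ip ?v ?w - (?B - 1) * (?c * ip ?w ?w)"
    proof -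
      have alg: "B * (x - c * y) + c * y = B * x - (B - 1) * (c * y)" for B c x y :: real
        by (simp add: algebra_simps)
      have sq: "(LBINT t. (?w t)\<^sup>2) = ip ?w ?w" by (simp add: ip_def power2_eq_square)
      show ?thesis unfolding IP I sq by (rule alg)
    qed
    \<comment> \<open>The dropped term is nonnegative because \<open>?B \<ge> 1\<close> and
      \<open>?c \<ge> 0\<close>.\<close>
    also have "\<dots> \<le> ?B * ip ?v ?w"
      using mult_nonneg_nonneg[of "?B - 1" "?c * ip ?w ?w"] B c wpos by simp
    finally show ?thesis by (simp add: corr_def ip_def)
  qed
  have cm: "corr ?v ?w \<in> borel_measurable borel"
    by (intro corr_measurable L2_measurable v w)
  note cb = corr_le[OF v w]
  have "hint hp (corr ?v ?w) \<le> hint hp (\<lambda>_. ip ?v ?w)"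
    by (rule hint_mono[OF hp cm]) (use cb up in auto)
  moreover have "hint hm (\<lambda>_. - (?B * ip ?v ?w)) \<le> hint hm (corr ?v ?w)"
    by (rule hint_mono[OF hm _ _ cm]) (use cb lo in auto)
  ultimately have "ip ?v ?w * (1 - H_norm hp - ?B * H_norm hm) \<le> Mform hp hm ?v ?w"
    unfolding Mform_def hint_const[OF hp] hint_const[OF hm] by (simp add: algebra_simps)
  moreover have "0 \<le> ip ?v ?w * (1 - H_norm hp - ?B * H_norm hm)"
    using pos H by (intro mult_nonneg_nonneg) auto
  ultimately show ?thesis by linarith
qed

lemma multiplier_ip:
  assumes "hp \<in> H_space" "hm \<in> H_space" "x \<in> L2" "y \<in> L2"
  shows "integrable lborel (\<lambda>t. multiplier hp hm x t * y t)"
    and "(LBINT t. multiplier hp hm x t * y t) = Mform hp hm x y"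
proof -
  have e: "multiplier hp hm x t * y t = x t * y t - conv_op hp x t * y t + conv_op hm x t * y t" for t
    by (simp add: multiplier_def algebra_simps)
  note i = L2_mult_integrable[OF assms(3,4)] conv_op_ip(1)[OF assms(1,3,4)] conv_op_ip(1)[OF assms(2,3,4)]
  show "integrable lborel (\<lambda>t. multiplier hp hm x t * y t)"
    unfolding e by (intro Bochner_Integration.integrable_add Bochner_Integration.integrable_diff i)
  show "(LBINT t. multiplier hp hm x t * y t) = Mform hp hm x y"
    unfolding e Mform_def using conv_op_ip(2)[OF assms(1,3,4)] conv_op_ip(2)[OF assms(2,3,4)] i
    by (simp add: ip_def)
qed

section \<open>Correlations across the truncation time\<close>

text \<open>A nonzero product requires \<open>t \<le> T < t - \<tau>\<close>, so only the last
  stretch of \<open>y\<close>, of length at most \<open>\<bar>\<tau>\<bar>\<close>, is seen. Its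
  norm is at most \<open>C * sqrt \<bar>\<tau>\<bar>\<close> however large the norm of
  \<open>y\<close> is.\<close>

lemma corr_disjoint_supports:
  assumes x: "x \<in> L2" "\<And>t. t \<le> T \<Longrightarrow> x t = 0"
    and y: "y \<in> L2" "\<And>t. t > T \<Longrightarrow> y t = 0" "\<And>t. \<bar>y t\<bar> \<le> C"
  shows "\<bar>corr x y \<tau>\<bar> \<le> L2_norm x * (C * sqrt \<bar>\<tau>\<bar>)"
proof -
  have C: "0 \<le> C" using y(3) abs_ge_zero order_trans by blast
  define z where "z t = (if T - \<bar>\<tau>\<bar> \<le> t \<and> t \<le> T then y t else 0)" for t
  have [measurable]: "y \<in> borel_measurable borel" by (rule L2_measurable[OF y(1)])
  have zL: "z \<in> L2"
    by (rule L2_bound[OF _ y(1)]) (auto simp: z_def[abs_def])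
  have "x (t - \<tau>) * y t = x (t - \<tau>) * z t" for t
    using x(2)[of "t - \<tau>"] y(2)[of t] by (auto simp: z_def)
  then have "corr x y \<tau> = corr x z \<tau>"
    unfolding corr_def ip_def by (intro Bochner_Integration.integral_cong refl)
  moreover have "L2_norm z \<le> C * sqrt \<bar>\<tau>\<bar>"
  proof -
    have "(LBINT t. (z t)\<^sup>2) \<le> (LBINT t. C\<^sup>2 * indicator {T - \<bar>\<tau>\<bar>..T} t)"
      using square_le_squareI[OF y(3)] L2_square_integrable[OF zL]
      by (intro integral_mono indicator_interval_integrable) (auto simp: z_def indicator_def)
    also have "\<dots> = C\<^sup>2 * \<bar>\<tau>\<bar>" by simp
    finally show ?thesis
      unfolding L2_norm_def using C real_sqrt_le_mono by (fastforce simp: real_sqrt_mult)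
  qed
  ultimately show ?thesis
    using corr_le[OF x(1) zL, of \<tau>] mult_left_mono[OF _ L2_norm_nonneg[of x], of "L2_norm z" "C * sqrt \<bar>\<tau>\<bar>"] by simp
qed

abbreviation outside :: "real \<Rightarrow> real \<Rightarrow> real" where
  "outside L \<equiv> (\<lambda>\<tau>. if L < \<bar>\<tau>\<bar> then 1 else 0)"

text \<open>Dominated convergence, separately for atoms and density.\<close>

lemma hint_outside_tendsto_0:
  assumes "h \<in> H_space"
  shows "(\<lambda>n. hint h (outside (real n))) \<longlonglongrightarrow> 0"
proof -
  have ev: "(\<lambda>n. c *\<^sub>R outside (real n) \<tau>) \<longlonglongrightarrow> 0" for c \<tau> :: real
  proof (rule tendsto_eventually)
    obtain N where "\<bar>\<tau>\<bar> \<le> real N" using real_arch_simple by blast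
    then show "\<forall>\<^sub>F n in sequentially. c *\<^sub>R outside (real n) \<tau> = 0"
      unfolding eventually_sequentially by (intro exI[of _ N]) auto
  qed
  have dc: "(\<lambda>n. LINT \<tau>|N. c \<tau> *\<^sub>R outside (real n) \<tau>) \<longlonglongrightarrow> (LINT \<tau>|N. 0)"
    if "integrable N c" "\<And>n. integrable N (\<lambda>\<tau>. c \<tau> *\<^sub>R outside (real n) \<tau>)" for N :: "real measure" and c
  proof (rule integral_dominated_convergence[where w = "\<lambda>\<tau>. \<bar>c \<tau>\<bar>"])
    show "AE \<tau> in N. (\<lambda>n. c \<tau> *\<^sub>R outside (real n) \<tau>) \<longlonglongrightarrow> 0" using ev by (intro AE_I2)
    show "(\<lambda>\<tau>. c \<tau> *\<^sub>R outside (real n) \<tau>) \<in> borel_measurable N" for n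
      by (rule borel_measurable_integrable[OF that(2)])
  qed (use that in auto)
  have o: "outside L \<in> borel_measurable borel" "norm (outside L \<tau>) \<le> 1" for L \<tau> by auto
  show ?thesis
    unfolding hint_eq_integrals
    using tendsto_add[OF dc[OF H_space_atoms(1)[OF assms] hint_integrable(1)[OF assms o]]
        dc[OF H_space_dens[OF assms] hint_integrable(2)[OF assms o]]] by simp
qed

text \<open>Lags up to \<open>L\<close> use the square-root bound, larger ones plain Cauchy-Schwarz.
  The norm of \<open>y\<close> is thus multiplied only by the mass of \<open>h\<close> beyond
  \<open>L\<close>, which can be made small.\<close>

lemma hint_corr_disjoint_supports:
  assumes h: "h \<in> Hp_space"
    and x: "x \<in> L2" "\<And>t. t \<le> T \<Longrightarrow> x t = 0"
    and y: "y \<in> L2" "\<And>t. t > T \<Longrightarrow> y t = 0" "\<And>t. \<bar>y t\<bar> \<le> C"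
    and L: "0 \<le> L"
  shows "\<bar>hint h (corr x y)\<bar> \<le> L2_norm x * (C * sqrt L * H_norm h + L2_norm y * hint h (outside L))"
proof -
  have C: "0 \<le> C" using y(3) abs_ge_zero order_trans by blast
  have hH: "h \<in> H_space" using h by (simp add: Hp_space_def)
  let ?a = "L2_norm x * (C * sqrt L)" and ?b = "L2_norm x * L2_norm y"
  let ?g = "\<lambda>\<tau>. ?a + ?b * outside L \<tau>"
  have ab: "0 \<le> ?a" "0 \<le> ?b" using C L by (auto simp: L2_norm_nonneg)
  have cm: "corr x y \<in> borel_measurable borel" by (intro corr_measurable L2_measurable x y)
  note cb = corr_le[OF x(1) y(1)]
  have le: "\<bar>corr x y \<tau>\<bar> \<le> ?g \<tau>" for \<tau>
  proof (cases "L < \<bar>\<tau>\<bar>")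
    case True
    then show ?thesis using cb[of \<tau>] ab by simp
  next
    case False
    have "\<bar>corr x y \<tau>\<bar> \<le> L2_norm x * (C * sqrt \<bar>\<tau>\<bar>)"
      using corr_disjoint_supports[where T = T and C = C, OF x y] .
    also have "\<dots> \<le> ?a" using False C by (intro mult_left_mono) (auto simp: L2_norm_nonneg)
    finally show ?thesis using False by simp
  qed
  have gm: "?g \<in> borel_measurable borel" by measurable
  have gb: "norm (?g \<tau>) \<le> ?a + ?b" for \<tau> using ab by auto
  have g: "hint h ?g = ?a * H_norm h + ?b * hint h (outside L)"
  proof -
    have "hint h ?g = hint h (\<lambda>_. ?a) + hint h (\<lambda>\<tau>. ?b * outside L \<tau>)"
      by (rule hint_add[OF hH, where K = ?a and K' = ?b]) (use ab in auto)
    then show ?thesis by (simp only: hint_const[OF h] hint_scale)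
  qed
  have "hint h (corr x y) \<le> hint h ?g"
    by (rule hint_mono[OF h cm _ gm gb]) (use cb le in \<open>auto simp: abs_le_iff\<close>)
  moreover have "hint h (\<lambda>\<tau>. (-1) * ?g \<tau>) \<le> hint h (corr x y)"
  proof (rule hint_mono[OF h _ _ cm])
    show "(\<lambda>\<tau>. (-1) * ?g \<tau>) \<in> borel_measurable borel" by measurable
    show "norm ((-1) * ?g \<tau>) \<le> ?a + ?b" for \<tau> using gb[of \<tau>] by simp
    show "norm (corr x y \<tau>) \<le> L2_norm x * L2_norm y" for \<tau> using cb by simp
    show "(-1) * ?g \<tau> \<le> corr x y \<tau>" for \<tau>
      using abs_le_D2[OF le[of \<tau>]] by (subst mult_minus1, subst minus_le_iff)
  qed
  ultimately have "\<bar>hint h (corr x y)\<bar> \<le> hint h ?g"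
    unfolding hint_scale by linarith
  then show ?thesis unfolding g by (simp add: algebra_simps)
qed

section \<open>The uniform bound on truncations\<close>

text \<open>Fatou's lemma along integer truncation times.\<close>

lemma L2_of_truncations:
  assumes w: "w \<in> borel_measurable borel" "\<And>T. trunc T w \<in> L2" "\<And>T. L2_norm (trunc T w) \<le> K"
  shows "w \<in> L2"
proof (rule L2_I[OF w(1)])
  note w(1)[measurable]
  have tm [measurable]: "trunc T w \<in> borel_measurable borel" for T by (rule L2_measurable[OF w(2)])
  have fin: "(\<integral>\<^sup>+t. ennreal ((trunc T w t)\<^sup>2) \<partial>lborel) \<le> ennreal (K\<^sup>2)" for T
  proof -
    have "(LBINT t. (trunc T w t)\<^sup>2) = (L2_norm (trunc T w))\<^sup>2"
      unfolding L2_norm_power2 ip_def by (simp add: power2_eq_square)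
    also have "\<dots> \<le> K\<^sup>2" using w(3)[of T] by (intro power_mono L2_norm_nonneg)
    finally show ?thesis
      by (subst nn_integral_eq_integral[OF L2_square_integrable[OF w(2)]]) (auto intro: ennreal_leI)
  qed
  have "(\<integral>\<^sup>+t. ennreal ((w t)\<^sup>2) \<partial>lborel)
      = (\<integral>\<^sup>+t. liminf (\<lambda>n. ennreal ((trunc (real n) w t)\<^sup>2)) \<partial>lborel)"
  proof (intro nn_integral_cong)
    fix t
    obtain N where N: "t \<le> real N" using real_arch_simple by blast
    have "(\<lambda>n. ennreal ((trunc (real n) w t)\<^sup>2)) \<longlonglongrightarrow> ennreal ((w t)\<^sup>2)"
    proof (rule tendsto_eventually)
      show "\<forall>\<^sub>F n in sequentially. ennreal ((trunc (real n) w t)\<^sup>2) = ennreal ((w t)\<^sup>2)"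
        unfolding eventually_sequentially using N by (intro exI[of _ N]) (auto simp: trunc_def)
    qed
    then show "ennreal ((w t)\<^sup>2) = liminf (\<lambda>n. ennreal ((trunc (real n) w t)\<^sup>2))"
      using lim_imp_Liminf[OF trivial_limit_sequentially] by metis
  qed
  also have "\<dots> \<le> liminf (\<lambda>n. \<integral>\<^sup>+t. ennreal ((trunc (real n) w t)\<^sup>2) \<partial>lborel)"
    by (rule nn_integral_liminf) measurable
  also have "\<dots> \<le> liminf (\<lambda>n. ennreal (K\<^sup>2))"
    by (rule Liminf_mono) (use fin in simp)
  also have "\<dots> < \<infinity>" by (simp add: Liminf_const)
  finally show "integrable lborel (\<lambda>t. (w t)\<^sup>2)"
    by (intro integrableI_bounded) auto
qed

lemma sat_feedback_L2:
  fixes s m n k :: real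
  assumes par: "s > 0" "m > 0" "n > 0" "k \<ge> s"
    and G: "linear_op G" "causal G" "stable_op G"
    and hp: "hp \<in> Hp_space" and hm: "hm \<in> Hp_space"
    and H: "H_norm hp + (max m n / min m n) * H_norm hm < 1"
    and fr: "frequency_response G Gj" and \<epsilon>: "\<epsilon> > 0"
    and eps: "\<And>\<omega>. Re (multiplier_freq hp hm \<omega> * (1 + complex_of_real k * Gj \<omega>)) \<ge> \<epsilon>"
    and f: "f \<in> L2" and u: "u \<in> L2e" and wu: "sat_op s (-m) n u \<in> L2e"
    and loop: "u \<doteq> (\<lambda>t. f t - G (sat_op s (-m) n u) t)"
  shows "sat_op s (-m) n u \<in> L2"
proof -
  define w where "w = sat_op s (-m) n u"
  have k: "k > 0" using par by simp
  have h: "hp \<in> H_space" "hm \<in> H_space" using hp hm by (auto simp: Hp_space_def)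
  obtain \<gamma>0 where GL: "\<And>u. u \<in> L2 \<Longrightarrow> G u \<in> L2" and \<gamma>0: "\<And>u. u \<in> L2 \<Longrightarrow> L2_norm (G u) \<le> \<gamma>0 * L2_norm u"
    using G(3) by (auto simp: stable_op_def)
  \<comment> \<open>A strictly positive gain, as the constant from stability comes without a
    sign.\<close>
  define \<gamma> where "\<gamma> = \<bar>\<gamma>0\<bar> + 1"
  have \<gamma>: "L2_norm (G u) \<le> \<gamma> * L2_norm u" if "u \<in> L2" for u
  proof -
    have "\<gamma>0 \<le> \<gamma>" by (simp add: \<gamma>_def)
    then show ?thesis
      using \<gamma>0[OF that] mult_right_mono[of \<gamma>0 \<gamma> "L2_norm u"] L2_norm_nonneg[of u] by linarith
  qed
  have \<gamma>pos: "\<gamma> > 0" by (simp add: \<gamma>_def)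
  define C where "C = m + n"
  have wC: "\<bar>w t\<bar> \<le> C" for t
    using sat_abs_le(1)[OF par(1-3)] by (simp add: w_def sat_op_def C_def)
  have C: "C > 0" using par by (simp add: C_def)
  \<comment> \<open>The cut-off lag is chosen so that the large lags use up at most half of
    \<open>\<epsilon>\<close>. It does not depend on \<open>T\<close>.\<close>
  have "(\<lambda>i. k * \<gamma> * (hint hp (outside (real i)) + hint hm (outside (real i)))) \<longlonglongrightarrow> k * \<gamma> * (0 + 0)"
    by (intro tendsto_intros hint_outside_tendsto_0 h)
  then have "\<forall>\<^sub>F i in sequentially. k * \<gamma> * (hint hp (outside (real i)) + hint hm (outside (real i))) < \<epsilon> / 2"
    using \<epsilon> by (intro order_tendstoD(2)[where a = "\<epsilon> / 2"]) auto
  then obtain i where i: "k * \<gamma> * (hint hp (outside (real i)) + hint hm (outside (real i))) < \<epsilon> / 2"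
    by (meson eventually_sequentially order_refl)
  define L where "L = real i"
  \<comment> \<open>\<open>R\<close> collects the coefficients of all terms linear in the norm of
    the truncated \<open>w\<close>.\<close>
  define R where "R = k * ((1 + H_norm hp + H_norm hm) * L2_norm f + \<gamma> * (C * sqrt L * (H_norm hp + H_norm hm)))"
  have R: "0 \<le> R"
    unfolding R_def L_def using k \<gamma>pos C by (intro mult_nonneg_nonneg add_nonneg_nonneg) (auto simp: H_norm_nonneg L2_norm_nonneg)
  have wL2e: "w \<in> L2e" using wu by (simp add: w_def)
  have bound: "L2_norm (trunc T w) \<le> 2 * R / \<epsilon>" for T
  proof -
    let ?w = "trunc T w" and ?u = "trunc T u" and ?f = "trunc T f"
    let ?v = "\<lambda>t. ?u t - ?w t / k"
    define q where "q t = (if t \<le> T then 0 else G ?w t)" for t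
    \<comment> \<open>Saturation fixes 0 and hence commutes with truncation, so positivity can be
      applied to the truncated input, which is in \<open>L2\<close>.\<close>
    have sat: "sat_op s (-m) n ?u = ?w"
      using sat_0[OF par(1-3)] by (auto simp: w_def sat_op_def trunc_def)
    have wT: "?w \<in> L2" and uT: "?u \<in> L2" using wL2e u by (auto simp: L2e_def)
    have fT: "?f \<in> L2" using L2_subset_L2e[OF f] by (simp add: L2e_def)
    have vT: "?v \<in> L2" by (intro L2_diff uT L2_divide wT)
    note gw = GL[OF wT]
    have [measurable]: "G ?w \<in> borel_measurable borel" by (rule L2_measurable[OF gw])
    have qm [measurable]: "q \<in> borel_measurable borel" unfolding q_def[abs_def] by measurable
    have qle: "\<bar>q t\<bar> \<le> \<bar>G ?w t\<bar>" for t by (simp add: q_def)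
    have q: "q \<in> L2" by (rule L2_bound[OF qm gw qle])
    have qn: "L2_norm q \<le> \<gamma> * L2_norm ?w"
      using L2_norm_mono[OF qm gw qle] \<gamma>[OF wT] by simp
    \<comment> \<open>Up to \<open>T\<close>, the loop and causality give
      \<open>w + k * G ?w = k * (f - v)\<close>; after \<open>T\<close> only the response
      \<open>q\<close> remains.\<close>
    let ?a = "\<lambda>t. ?w t + k * G ?w t" and ?a' = "\<lambda>t. k * ((?f t - ?v t) + q t)"
    have aL: "?a \<in> L2" by (intro L2_add wT L2_scale gw)
    have a'L: "?a' \<in> L2" by (intro L2_scale L2_add L2_diff fT vT q)
    have caus: "trunc T (G w) \<doteq> trunc T (G ?w)"
      using G(2) wL2e by (simp add: causal_def)
    have "AE t in lborel. ?a t - ?a' t = 0"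
      using caus loop unfolding ae_eq_def w_def[symmetric]
    proof eventually_elim
      fix t assume 1: "trunc T (G w) t = trunc T (G ?w) t" and 2: "u t = f t - G w t"
      show "?a t - ?a' t = 0"
      proof (cases "t \<le> T")
        case True
        then have tr: "trunc T x t = x t" for x by (simp add: trunc_def)
        have "f t = u t + G ?w t" using 1 2 unfolding tr by simp
        then show ?thesis using True k by (simp add: tr q_def distrib_left)
      next
        case False
        then show ?thesis by (simp add: q_def trunc_def)
      qed
    qed
    \<comment> \<open>The two signals agree only almost everywhere; their difference has norm 0, and
      boundedness makes the form vanish on it.\<close>
    then have "(\<lambda>t. ?a t - ?a' t) \<doteq> (\<lambda>t. 0)" by (simp add: ae_eq_def)
    then have "L2_norm (\<lambda>t. ?a t - ?a' t) = L2_norm (\<lambda>t. 0)"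
      by (rule L2_norm_ae_eq) (use L2_measurable[OF L2_diff[OF aL a'L]] in auto)
    then have "L2_norm (\<lambda>t. ?a t - ?a' t) = 0" by (simp add: L2_norm_def)
    then have "Mform hp hm (\<lambda>t. ?a t - ?a' t) ?w = 0"
      using Mform_bound[OF h L2_diff[OF aL a'L] wT] by simp
    then have eq: "Mform hp hm ?a ?w = Mform hp hm ?a' ?w"
      using Mform_diff_left[OF h aL a'L wT] by simp
    have wTC: "\<bar>?w t\<bar> \<le> C" for t using wC[of t] C by (simp add: trunc_def)
    have "\<epsilon> * ip ?w ?w \<le> Mform hp hm ?w ?w + k * Mform hp hm (G ?w) ?w"
      by (rule frequency_inequality[OF h G(1,3) fr eps wT wTC])
    also have "\<dots> = Mform hp hm ?a ?w"
      by (simp add: Mform_add_left[OF h wT L2_scale[OF gw] wT] Mform_scale_left)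
    also have "\<dots> = k * (Mform hp hm ?f ?w - Mform hp hm ?v ?w + Mform hp hm q ?w)"
      unfolding eq Mform_scale_left
      by (simp only: Mform_add_left[OF h L2_diff[OF fT vT] q wT] Mform_diff_left[OF h fT vT wT])
    also have "\<dots> \<le> k * (Mform hp hm ?f ?w + Mform hp hm q ?w)"
      using Mform_sat_nonneg[OF par hp hm H uT] k unfolding sat by (intro mult_left_mono) auto
    also have "\<dots> \<le> L2_norm ?w * R + \<epsilon> / 2 * (L2_norm ?w)\<^sup>2"
    proof -
      have fle: "L2_norm ?f \<le> L2_norm f"
        by (rule L2_norm_mono[OF L2_measurable[OF fT] f]) (simp add: trunc_def)
      have 1: "Mform hp hm ?f ?w \<le> (1 + H_norm hp + H_norm hm) * (L2_norm f * L2_norm ?w)"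
      proof -
        have "Mform hp hm ?f ?w \<le> (1 + H_norm hp + H_norm hm) * (L2_norm ?f * L2_norm ?w)"
          using Mform_bound[OF h fT wT] by linarith
        also have "\<dots> \<le> (1 + H_norm hp + H_norm hm) * (L2_norm f * L2_norm ?w)"
          using fle
          by (intro mult_left_mono mult_right_mono) (auto simp: L2_norm_nonneg H_norm_nonneg)
        finally show ?thesis .
      qed
      \<comment> \<open>Supports before and after \<open>T\<close> are disjoint, so the identity
        part of the multiplier contributes nothing.\<close>
      have "(\<lambda>t. q t * ?w t) = (\<lambda>t. 0)" by (auto simp: q_def trunc_def)
      then have ip0: "ip q ?w = 0" by (simp add: ip_def)
      let ?E = "\<lambda>h. C * sqrt L * H_norm h + L2_norm ?w * hint h (outside L)"
      have hb: "\<bar>hint h (corr q ?w)\<bar> \<le> L2_norm q * ?E h" if "h \<in> Hp_space" for h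
        by (rule hint_corr_disjoint_supports[where T = T, OF that q _ wT _ wTC])
          (auto simp: q_def trunc_def L_def)
      have E0: "0 \<le> ?E h" if "h \<in> Hp_space" for h
      proof -
        have "0 \<le> hint h (outside L)"
          using that unfolding hint_eq_integrals Hp_space_def
          by (intro add_nonneg_nonneg Bochner_Integration.integral_nonneg) auto
        then show ?thesis using C by (simp add: L_def H_norm_nonneg L2_norm_nonneg)
      qed
      have "Mform hp hm q ?w \<le> L2_norm q * (?E hp + ?E hm)"
        unfolding Mform_def ip0 using hb[OF hp] hb[OF hm] by (simp add: distrib_left)
      also have "\<dots> \<le> (\<gamma> * L2_norm ?w) * (?E hp + ?E hm)"
        using qn E0[OF hp] E0[OF hm] by (intro mult_right_mono) auto
      finally have 2: "Mform hp hm q ?w \<le> (\<gamma> * L2_norm ?w) * (?E hp + ?E hm)" .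
      have "k * (Mform hp hm ?f ?w + Mform hp hm q ?w)
          \<le> k * ((1 + H_norm hp + H_norm hm) * (L2_norm f * L2_norm ?w) + (\<gamma> * L2_norm ?w) * (?E hp + ?E hm))"
        using 1 2 k by (intro mult_left_mono) auto
      also have "\<dots> = L2_norm ?w * R + k * \<gamma> * (hint hp (outside L) + hint hm (outside L)) * (L2_norm ?w)\<^sup>2"
        by (simp add: R_def power2_eq_square algebra_simps)
      also have "\<dots> \<le> L2_norm ?w * R + \<epsilon> / 2 * (L2_norm ?w)\<^sup>2"
        using i unfolding L_def by (intro add_left_mono mult_right_mono) auto
      finally show ?thesis .
    qed
    finally have "\<epsilon> / 2 * (L2_norm ?w)\<^sup>2 \<le> L2_norm ?w * R"
      by (simp add: L2_norm_power2[symmetric])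
    then have "L2_norm ?w * (\<epsilon> / 2 * L2_norm ?w) \<le> L2_norm ?w * R"
      by (simp add: power2_eq_square mult_ac)
    \<comment> \<open>Dividing by the norm leaves a bound free of \<open>T\<close>; a zero norm
      satisfies it because \<open>R \<ge> 0\<close>.\<close>
    then have "L2_norm ?w = 0 \<or> \<epsilon> / 2 * L2_norm ?w \<le> R"
      using L2_norm_nonneg[of ?w] mult_le_cancel_left_pos[of "L2_norm ?w" "\<epsilon> / 2 * L2_norm ?w" R] by linarith
    then show ?thesis
      using R \<epsilon> by (auto simp: field_simps)
  qed
  have "w \<in> L2"
    by (rule L2_of_truncations[OF _ _ bound]) (use wL2e in \<open>auto simp: L2e_def\<close>)
  then show ?thesis by (simp add: w_def)
qed

section \<open>The closed loop\<close>

lemma L2e_diff: "x \<in> L2e \<Longrightarrow> y \<in> L2e \<Longrightarrow> (\<lambda>t. x t - y t) \<in> L2e"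
proof -
  assume x: "x \<in> L2e" and y: "y \<in> L2e"
  have "trunc T (\<lambda>t. x t - y t) = (\<lambda>t. trunc T x t - trunc T y t)" for T
    by (auto simp: trunc_def)
  then show ?thesis using x y L2_diff by (auto simp: L2e_def)
qed

lemma sat_op_L2e:
  assumes "s > 0" "m > 0" "n > 0" "u \<in> L2e"
  shows "sat_op s (-m) n u \<in> L2e"
proof -
  have "trunc T (sat_op s (-m) n u) = sat_op s (-m) n (trunc T u)" for T
    using sat_0[OF assms(1-3)] by (auto simp: sat_op_def trunc_def)
  then show ?thesis
    using assms sat_op_L2[OF assms(1-3)] sat_measurable by (auto simp: L2e_def)
qed

theorem corollary4:
  fixes s m n k :: real and G :: sysop and hp hm :: gen_fun
  assumes "s > 0" and "m > 0" and "n > 0" and "k \<ge> s"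
    and "L2e_operator G" and "linear_op G" and "time_invariant G" and "causal G" and "stable_op G"
    and "lurye_well_posed G (sat_op s (-m) n)"
    and "hp \<in> Hp_space" and "hm \<in> Hp_space"
    and "H_norm hp + (max m n / min m n) * H_norm hm < 1"
  shows "(\<forall>u\<in>L2.
            integrable lborel (\<lambda>t. multiplier hp hm (\<lambda>t. u t - sat_op s (-m) n u t / k) t
                                   * sat_op s (-m) n u t) \<and>
            (LBINT t. multiplier hp hm (\<lambda>t. u t - sat_op s (-m) n u t / k) t
                      * sat_op s (-m) n u t) \<ge> 0)
       \<and> (\<forall>Gj. frequency_response G Gj \<longrightarrow>
            (\<exists>\<epsilon>>0. \<forall>\<omega>. Re (multiplier_freq hp hm \<omega> * (1 + complex_of_real k * Gj \<omega>)) \<ge> \<epsilon>) \<longrightarrow>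
            lurye_stable G (sat_op s (-m) n))"
proof (intro conjI ballI allI impI)
  have h: "hp \<in> H_space" "hm \<in> H_space" using assms(11,12) by (auto simp: Hp_space_def)
  let ?\<phi> = "sat_op s (-m) n"
  {
    fix u assume u: "u \<in> L2"
    have w: "?\<phi> u \<in> L2" by (rule sat_op_L2[OF assms(1-3) u])
    have v: "(\<lambda>t. u t - ?\<phi> u t / k) \<in> L2" by (intro L2_diff u L2_divide w)
    show "integrable lborel (\<lambda>t. multiplier hp hm (\<lambda>t. u t - ?\<phi> u t / k) t * ?\<phi> u t)"
      by (rule multiplier_ip(1)[OF h v w])
    show "(LBINT t. multiplier hp hm (\<lambda>t. u t - ?\<phi> u t / k) t * ?\<phi> u t) \<ge> 0"
      unfolding multiplier_ip(2)[OF h v w] by (rule Mform_sat_nonneg[OF assms(1-4,11-13) u])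
  }
  fix Gj
  assume fr: "frequency_response G Gj"
    and "\<exists>\<epsilon>>0. \<forall>\<omega>. Re (multiplier_freq hp hm \<omega> * (1 + complex_of_real k * Gj \<omega>)) \<ge> \<epsilon>"
  then obtain \<epsilon> where \<epsilon>: "\<epsilon> > 0" "\<And>\<omega>. Re (multiplier_freq hp hm \<omega> * (1 + complex_of_real k * Gj \<omega>)) \<ge> \<epsilon>"
    by blast
  show "lurye_stable G ?\<phi>"
    unfolding lurye_stable_def
  proof (intro ballI allI impI)
    fix r1 r2 u1 u2 y1 y2
    assume r: "r1 \<in> L2" "r2 \<in> L2" and sol: "lurye_solution G ?\<phi> r1 r2 u1 u2 y1 y2"
    note sol = sol[unfolded lurye_solution_def]
    have GL: "G x \<in> L2" if "x \<in> L2" for x using assms(9) that by (auto simp: stable_op_def)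
    let ?w = "?\<phi> u2"
    have u2: "u2 \<in> L2e" using sol by simp
    have w: "?w \<in> L2e" by (rule sat_op_L2e[OF assms(1-3) u2])
    have r1e: "r1 \<in> L2e" by (rule L2_subset_L2e[OF r(1)])
    let ?x = "\<lambda>t. r1 t - ?w t"
    have u1x: "u1 \<doteq> ?x"
    proof -
      have "y2 \<doteq> ?w" "u1 \<doteq> (\<lambda>t. r1 t - y2 t)" using sol by auto
      then show ?thesis unfolding ae_eq_def by eventually_elim simp
    qed
    have "G u1 \<doteq> G ?x"
      using assms(5) u1x sol L2e_diff[OF r1e w] unfolding L2e_operator_def by blast
    moreover have "G (\<lambda>t. 1 * r1 t + (-1) * ?w t) \<doteq> (\<lambda>t. 1 * G r1 t + (-1) * G ?w t)"
      by (rule assms(6)[unfolded linear_op_def, rule_format, OF r1e w])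
    moreover have "y1 \<doteq> G u1" "u2 \<doteq> (\<lambda>t. y1 t + r2 t)" using sol by auto
    \<comment> \<open>Eliminating \<open>u1\<close> and \<open>y1\<close> by linearity puts the
      system in single-loop form with the square-integrable input \<open>G r1 + r2\<close>.\<close>
    ultimately have loop: "u2 \<doteq> (\<lambda>t. (G r1 t + r2 t) - G ?w t)"
      unfolding ae_eq_def mult_1 mult_minus1 by eventually_elim simp
    have f: "(\<lambda>t. G r1 t + r2 t) \<in> L2" by (intro L2_add GL r)
    have wL: "?w \<in> L2"
      by (rule sat_feedback_L2[OF assms(1-4,6,8,9,11-13) fr \<epsilon> f u2 w loop])
    have m: "u1 \<in> borel_measurable borel" "u2 \<in> borel_measurable borel"
      "y1 \<in> borel_measurable borel" "y2 \<in> borel_measurable borel"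
      using sol by (auto simp: L2e_def)
    have sym: "a \<doteq> b \<Longrightarrow> b \<doteq> a" for a b :: signal unfolding ae_eq_def by (auto elim: AE_mp)
    \<comment> \<open>Once the saturated signal is in \<open>L2\<close>, the others follow around
      the loop, each almost everywhere equal to a signal already known to be in
      \<open>L2\<close>.\<close>
    have y2L: "y2 \<in> L2" using L2_ae_eq[OF wL m(4)] sym sol by blast
    have u1L: "u1 \<in> L2" using L2_ae_eq[OF L2_diff[OF r(1) y2L] m(1)] sym sol by blast
    have y1L: "y1 \<in> L2" using L2_ae_eq[OF GL[OF u1L] m(3)] sym sol by blast
    have u2L: "u2 \<in> L2" using L2_ae_eq[OF L2_add[OF y1L r(2)] m(2)] sym sol by blast
    show "u1 \<in> L2 \<and> u2 \<in> L2 \<and> y1 \<in> L2 \<and> y2 \<in> L2" using u1L u2L y1L y2L by blast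
  qed
qed

end
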